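(* Let $R$ be a semiprime left Goldie ring with an injective endomorphism $\sigma$, and let $R\subseteq_{\sigma} A$ be the corresponding Jordan extension. Then for any $\sigma$-derivation $\delta$ of $R$, $$\mathrm{udim}\, R[x;\sigma,\delta]=\mathrm{udim}\, R=\mathrm{udim}\, A .$$
   Context: All rings are associative with unity, and ring endomorphisms preserve the unity. For a ring $R$ with injective endomorphism $\sigma$, a Jordan extension of $R$, written $R\subseteq_\sigma A$, is an over-ring $A$ of $R$ such that $\sigma$ extends to an automorphism of $A$ (again denoted $\sigma$) and $A=\bigcup_{i=0}^\infty \sigma^{-i}(R)$; it always exists and is unique up to an isomorphism that is the identity on $R$. A $\sigma$-derivation of $R$ is an additive map $\delta:R\to R$ with $\delta(ab)=\sigma(a)\delta(b)+\delta(a)b$. The Ore extension $R[x;\sigma,\delta]$ is the ring of polynomials $\sum a_ix^i$ with coefficients from $R$ written on the left and multiplication determined by $xr=\sigma(r)x+\delta(r)$ for $r\in R$. $\mathrm{udim}$ denotes left uniform (Goldie) dimension. A ring is left Goldie if it has finite left uniform dimension and satisfies the ascending chain condition on left annihilators. *)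

theory Defs
  imports "HOL-Algebra.UnivPoly" "HOL-Algebra.Ideal_Product" "HOL-Algebra.QuotRing"
     "HOL-Library.Extended_Nat"
begin

(* The predicate ideal of HOL-Algebra is two-sided. *)
definition left_ideal :: "'a set \<Rightarrow> ('a, 'm) ring_scheme \<Rightarrow> bool" where
  "left_ideal I R \<longleftrightarrow>
     additive_subgroup I R \<and> (\<forall>r\<in>carrier R. \<forall>a\<in>I. r \<otimes>\<^bsub>R\<^esub> a \<in> I)"

(* The sum I 0 + ... + I (n - 1) is direct. *)
definition independent_family :: "('a, 'm) ring_scheme \<Rightarrow> nat \<Rightarrow> (nat \<Rightarrow> 'a set) \<Rightarrow> bool" where
  "independent_family R n I \<longleftrightarrow>
     (\<forall>a. (\<forall>k<n. a k \<in> I k) \<and> (\<Oplus>\<^bsub>R\<^esub>k\<in>{..<n}. a k) = \<zero>\<^bsub>R\<^esub> \<longrightarrow> (\<forall>k<n. a k = \<zero>\<^bsub>R\<^esub>))"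

(* Supremum of the lengths of finite direct sums of nonzero left ideals; it is \<infinity> when there are
   arbitrarily long ones. *)
definition udim :: "('a, 'm) ring_scheme \<Rightarrow> enat" where
  "udim R = Sup {enat n | n. \<exists>I. (\<forall>k<n. left_ideal (I k) R \<and> I k \<noteq> {\<zero>\<^bsub>R\<^esub>}) \<and>
                                 independent_family R n I}"

definition left_annihilator :: "('a, 'm) ring_scheme \<Rightarrow> 'a set \<Rightarrow> 'a set" where
  "left_annihilator R S = {r \<in> carrier R. \<forall>s\<in>S. r \<otimes>\<^bsub>R\<^esub> s = \<zero>\<^bsub>R\<^esub>}"

definition acc_left_annihilators :: "('a, 'm) ring_scheme \<Rightarrow> bool" where
  "acc_left_annihilators R \<longleftrightarrow>
     (\<forall>L :: nat \<Rightarrow> 'a set. (\<forall>i. \<exists>S\<subseteq>carrier R. L i = left_annihilator R S) \<and> mono L \<longrightarrow>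
        (\<exists>n. \<forall>m\<ge>n. L m = L n))"

definition left_goldie :: "('a, 'm) ring_scheme \<Rightarrow> bool" where
  "left_goldie R \<longleftrightarrow> udim R \<noteq> \<infinity> \<and> acc_left_annihilators R"

(* The zero ideal is a semiprime ideal: the square of a nonzero two-sided ideal is nonzero. *)
definition semiprime_ring :: "('a, 'm) ring_scheme \<Rightarrow> bool" where
  "semiprime_ring R \<longleftrightarrow> (\<forall>I. ideal I R \<and> I \<cdot>\<^bsub>R\<^esub> I = {\<zero>\<^bsub>R\<^esub>} \<longrightarrow> I = {\<zero>\<^bsub>R\<^esub>})"

(* The inclusion of R into the over-ring A is an injective ring homomorphism \<iota>, so that the two
   rings may have different element types; a literal over-ring is the case of the identity map.
   The automorphism \<tau> of A extends \<sigma>, and the i-th set of the union is the preimage of R under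
   the i-th power of \<tau>. *)
definition jordan_extension ::
  "('a, 'm) ring_scheme \<Rightarrow> ('a \<Rightarrow> 'a) \<Rightarrow> ('b, 'k) ring_scheme \<Rightarrow> ('a \<Rightarrow> 'b) \<Rightarrow> bool" where
  "jordan_extension R \<sigma> A \<iota> \<longleftrightarrow>
     ring A \<and> \<iota> \<in> ring_hom R A \<and> inj_on \<iota> (carrier R) \<and>
     (\<exists>\<tau>\<in>ring_iso A A. (\<forall>r\<in>carrier R. \<tau> (\<iota> r) = \<iota> (\<sigma> r)) \<and>
        carrier A = (\<Union>i. {a \<in> carrier A. (\<tau> ^^ i) a \<in> \<iota> ` carrier R}))"

definition sigma_derivation ::
  "('a, 'm) ring_scheme \<Rightarrow> ('a \<Rightarrow> 'a) \<Rightarrow> ('a \<Rightarrow> 'a) \<Rightarrow> bool" where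
  "sigma_derivation R \<sigma> \<delta> \<longleftrightarrow>
     \<delta> \<in> carrier R \<rightarrow> carrier R \<and>
     (\<forall>a\<in>carrier R. \<forall>b\<in>carrier R. \<delta> (a \<oplus>\<^bsub>R\<^esub> b) = \<delta> a \<oplus>\<^bsub>R\<^esub> \<delta> b \<and>
        \<delta> (a \<otimes>\<^bsub>R\<^esub> b) = \<sigma> a \<otimes>\<^bsub>R\<^esub> \<delta> b \<oplus>\<^bsub>R\<^esub> \<delta> a \<otimes>\<^bsub>R\<^esub> b)"

(* A polynomial is its sequence of left coefficients. Left multiplication by x sends
   the sum of the q_n x^n to the sum of the (\<sigma>(q_n) x + \<delta>(q_n)) x^n. *)
definition ore_x ::
  "('a, 'm) ring_scheme \<Rightarrow> ('a \<Rightarrow> 'a) \<Rightarrow> ('a \<Rightarrow> 'a) \<Rightarrow> (nat \<Rightarrow> 'a) \<Rightarrow> nat \<Rightarrow> 'a" where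
  "ore_x R \<sigma> \<delta> q = (\<lambda>n. (case n of 0 \<Rightarrow> \<zero>\<^bsub>R\<^esub> | Suc m \<Rightarrow> \<sigma> (q m)) \<oplus>\<^bsub>R\<^esub> \<delta> (q n))"

(* (sum of p_i x^i) q = sum of p_i (x^i q), over the finite support of p. *)
definition ore_mult ::
  "('a, 'm) ring_scheme \<Rightarrow> ('a \<Rightarrow> 'a) \<Rightarrow> ('a \<Rightarrow> 'a) \<Rightarrow> (nat \<Rightarrow> 'a) \<Rightarrow> (nat \<Rightarrow> 'a) \<Rightarrow> nat \<Rightarrow> 'a" where
  "ore_mult R \<sigma> \<delta> p q =
     (\<lambda>n. \<Oplus>\<^bsub>R\<^esub>i\<in>{i. p i \<noteq> \<zero>\<^bsub>R\<^esub>}. p i \<otimes>\<^bsub>R\<^esub> ((ore_x R \<sigma> \<delta> ^^ i) q) n)"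

definition ore_extension ::
  "('a, 'm) ring_scheme \<Rightarrow> ('a \<Rightarrow> 'a) \<Rightarrow> ('a \<Rightarrow> 'a) \<Rightarrow> (nat \<Rightarrow> 'a) ring" where
  "ore_extension R \<sigma> \<delta> = \<lparr>
     carrier = up R,
     mult = ore_mult R \<sigma> \<delta>,
     one = (\<lambda>n. if n = 0 then \<one>\<^bsub>R\<^esub> else \<zero>\<^bsub>R\<^esub>),
     zero = (\<lambda>n. \<zero>\<^bsub>R\<^esub>),
     add = (\<lambda>p q n. p n \<oplus>\<^bsub>R\<^esub> q n)\<rparr>"

locale ore_data = ring R for R (structure) +
  fixes \<sigma> \<delta> :: "'a \<Rightarrow> 'a"
  assumes endo: "\<sigma> \<in> ring_hom R R"
    and deriv: "sigma_derivation R \<sigma> \<delta>"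
begin

abbreviation "xop \<equiv> ore_x R \<sigma> \<delta>"
abbreviation "mlt \<equiv> ore_mult R \<sigma> \<delta>"

lemma sg_closed [simp, intro]: "a \<in> carrier R \<Longrightarrow> \<sigma> a \<in> carrier R"
  using endo by (simp add: ring_hom_closed)

lemma dl_closed [simp, intro]: "a \<in> carrier R \<Longrightarrow> \<delta> a \<in> carrier R"
  using deriv by (auto simp: sigma_derivation_def)

lemma sg_add [simp]: "a \<in> carrier R \<Longrightarrow> b \<in> carrier R \<Longrightarrow> \<sigma> (a \<oplus> b) = \<sigma> a \<oplus> \<sigma> b"
  using endo by (simp add: ring_hom_add)

lemma sg_mult [simp]: "a \<in> carrier R \<Longrightarrow> b \<in> carrier R \<Longrightarrow> \<sigma> (a \<otimes> b) = \<sigma> a \<otimes> \<sigma> b"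
  using endo by (simp add: ring_hom_mult)

lemma sg_one [simp]: "\<sigma> \<one> = \<one>"
  using endo by (simp add: ring_hom_one)

lemma sg_zero [simp]: "\<sigma> \<zero> = \<zero>"
  using endo ring_axioms by (simp add: ring_hom_zero)

lemma dl_add [simp]: "a \<in> carrier R \<Longrightarrow> b \<in> carrier R \<Longrightarrow> \<delta> (a \<oplus> b) = \<delta> a \<oplus> \<delta> b"
  using deriv by (auto simp: sigma_derivation_def)

lemma dl_mult [simp]:
  "a \<in> carrier R \<Longrightarrow> b \<in> carrier R \<Longrightarrow> \<delta> (a \<otimes> b) = \<sigma> a \<otimes> \<delta> b \<oplus> \<delta> a \<otimes> b"
  using deriv by (auto simp: sigma_derivation_def)

lemma dl_zero [simp]: "\<delta> \<zero> = \<zero>"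
proof -
  have "\<delta> \<zero> \<oplus> \<delta> \<zero> = \<delta> \<zero> \<oplus> \<zero>" using dl_add[of \<zero> \<zero>] by simp
  then show ?thesis by (simp del: r_zero)
qed

lemma dl_one [simp]: "\<delta> \<one> = \<zero>"
proof -
  have "\<delta> \<one> \<oplus> \<delta> \<one> = \<delta> \<one> \<oplus> \<zero>" using dl_mult[of \<one> \<one>] by simp
  then show ?thesis by (simp del: r_zero dl_mult)
qed

lemma X_closed [simp, intro]:
  assumes "q \<in> up R" shows "xop q \<in> up R"
proof
  show "xop q n \<in> carrier R" for n
    using mem_upD[OF assms] by (auto simp: ore_x_def split: nat.splits)
  obtain n where n: "bound \<zero> n q" using assms by auto
  have "bound \<zero> (Suc n) (xop q)"
    using bound.bound[OF n] by (auto simp: ore_x_def split: nat.splits)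
  then show "\<exists>n. bound \<zero> n (xop q)" ..
qed

lemma Xpow_closed [simp, intro]: "q \<in> up R \<Longrightarrow> (xop ^^ i) q \<in> up R"
  by (induction i) auto

lemma Xpow_carr [simp, intro]: "q \<in> up R \<Longrightarrow> (xop ^^ i) q n \<in> carrier R"
  by (rule mem_upD) auto

lemma X_add:
  assumes "p \<in> up R" "q \<in> up R"
  shows "xop (\<lambda>n. p n \<oplus> q n) = (\<lambda>n. xop p n \<oplus> xop q n)"
proof
  fix n show "xop (\<lambda>n. p n \<oplus> q n) n = xop p n \<oplus> xop q n"
    using mem_upD[OF assms(1)] mem_upD[OF assms(2)]
    by (cases n) (simp_all add: ore_x_def a_ac)
qed

lemma Xpow_add:
  assumes "p \<in> up R" "q \<in> up R"
  shows "(xop ^^ i) (\<lambda>n. p n \<oplus> q n) = (\<lambda>n. (xop ^^ i) p n \<oplus> (xop ^^ i) q n)"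
  using assms by (induction i) (simp_all add: X_add)

lemma X_smult:
  assumes "a \<in> carrier R" "q \<in> up R"
  shows "xop (\<lambda>n. a \<otimes> q n) = (\<lambda>n. \<sigma> a \<otimes> xop q n \<oplus> \<delta> a \<otimes> q n)"
proof
  fix n show "xop (\<lambda>n. a \<otimes> q n) n = \<sigma> a \<otimes> xop q n \<oplus> \<delta> a \<otimes> q n"
    using mem_upD[OF assms(2)] assms(1)
    by (cases n) (simp_all add: ore_x_def a_ac r_distr)
qed

lemma mult_eq:
  assumes p: "p \<in> up R" and q: "q \<in> up R" and N: "\<And>i. N < i \<Longrightarrow> p i = \<zero>"
  shows "mlt p q n = (\<Oplus>i\<in>{..N}. p i \<otimes> (xop ^^ i) q n)"
  unfolding ore_mult_def
proof (rule add.finprod_mono_neutral_cong_left)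
  show "{i. p i \<noteq> \<zero>} \<subseteq> {..N}" using N by (auto simp: not_less[symmetric])
qed (use mem_upD[OF p] q in auto)

lemma up_common_bound:
  assumes "p \<in> up R" "q \<in> up R"
  obtains N where "\<And>i. N < i \<Longrightarrow> p i = \<zero>" "\<And>i. N < i \<Longrightarrow> q i = \<zero>"
proof -
  obtain n m where "bound \<zero> n p" "bound \<zero> m q" using assms by blast
  then show thesis using that[of "max n m"] by (auto dest: bound.bound)
qed

lemma up_finsum:
  assumes "finite F" "\<And>i. i \<in> F \<Longrightarrow> f i \<in> up R"
  shows "(\<lambda>n. \<Oplus>i\<in>F. f i n) \<in> up R"
  using assms
proof (induction F rule: finite_induct)
  case empty
  show ?case by (auto simp: up_def)
next
  case (insert k F)
  have "(\<lambda>n. \<Oplus>i\<in>insert k F. f i n) = (\<lambda>n. f k n \<oplus> (\<Oplus>i\<in>F. f i n))"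
    using insert by (subst finsum_insert) (auto intro: mem_upD)
  then show ?case using insert up_add_closed[of "f k"] by auto
qed

lemma mult_closed [simp, intro]:
  assumes "p \<in> up R" "q \<in> up R" shows "mlt p q \<in> up R"
proof -
  obtain N where N: "\<And>i. N < i \<Longrightarrow> p i = \<zero>" using up_common_bound[OF assms] by metis
  have "mlt p q = (\<lambda>n. \<Oplus>i\<in>{..N}. p i \<otimes> (xop ^^ i) q n)"
    using mult_eq[OF assms N] by auto
  also have "\<dots> \<in> up R"
    using assms by (intro up_finsum up_smult_closed) auto
  finally show ?thesis .
qed

lemma mult_add_left:
  assumes p: "p \<in> up R" and q: "q \<in> up R" and r: "r \<in> up R"
  shows "mlt (\<lambda>n. p n \<oplus> q n) r = (\<lambda>n. mlt p r n \<oplus> mlt q r n)"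
proof
  fix n
  obtain N where N: "\<And>i. N < i \<Longrightarrow> p i = \<zero>" "\<And>i. N < i \<Longrightarrow> q i = \<zero>"
    using up_common_bound[OF p q] by metis
  have "mlt (\<lambda>n. p n \<oplus> q n) r n = (\<Oplus>i\<in>{..N}. (p i \<oplus> q i) \<otimes> (xop ^^ i) r n)"
    using N p q r by (intro mult_eq) (auto simp: up_add_closed)
  also have "\<dots> = (\<Oplus>i\<in>{..N}. p i \<otimes> (xop ^^ i) r n \<oplus> q i \<otimes> (xop ^^ i) r n)"
    using p q r by (intro finsum_cong') (auto simp: l_distr mem_upD)
  also have "\<dots> = mlt p r n \<oplus> mlt q r n"
    using p q r by (subst finsum_addf) (auto simp: mult_eq[OF p r N(1)] mult_eq[OF q r N(2)] mem_upD)
  finally show "mlt (\<lambda>n. p n \<oplus> q n) r n = mlt p r n \<oplus> mlt q r n" .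
qed

lemma mult_add_right:
  assumes p: "p \<in> up R" and q: "q \<in> up R" and r: "r \<in> up R"
  shows "mlt r (\<lambda>n. p n \<oplus> q n) = (\<lambda>n. mlt r p n \<oplus> mlt r q n)"
proof
  fix n
  obtain N where N: "\<And>i. N < i \<Longrightarrow> r i = \<zero>" using up_common_bound[OF r r] by metis
  have "mlt r (\<lambda>n. p n \<oplus> q n) n = (\<Oplus>i\<in>{..N}. r i \<otimes> (xop ^^ i) (\<lambda>n. p n \<oplus> q n) n)"
    using N p q r by (intro mult_eq) (auto simp: up_add_closed)
  also have "\<dots> = (\<Oplus>i\<in>{..N}. r i \<otimes> (xop ^^ i) p n \<oplus> r i \<otimes> (xop ^^ i) q n)"
    using p q r by (intro finsum_cong') (auto simp: r_distr mem_upD Xpow_add)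
  also have "\<dots> = mlt r p n \<oplus> mlt r q n"
    using p q r by (subst finsum_addf) (auto simp: mult_eq[OF r p N] mult_eq[OF r q N] mem_upD)
  finally show "mlt r (\<lambda>n. p n \<oplus> q n) n = mlt r p n \<oplus> mlt r q n" .
qed

lemma mult_smult_left:
  assumes a: "a \<in> carrier R" and p: "p \<in> up R" and r: "r \<in> up R"
  shows "mlt (\<lambda>n. a \<otimes> p n) r = (\<lambda>n. a \<otimes> mlt p r n)"
proof
  fix n
  obtain N where N: "\<And>i. N < i \<Longrightarrow> p i = \<zero>" using up_common_bound[OF p p] by metis
  have "mlt (\<lambda>n. a \<otimes> p n) r n = (\<Oplus>i\<in>{..N}. (a \<otimes> p i) \<otimes> (xop ^^ i) r n)"
    using N a p r by (intro mult_eq) (auto simp: up_smult_closed)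
  also have "\<dots> = (\<Oplus>i\<in>{..N}. a \<otimes> (p i \<otimes> (xop ^^ i) r n))"
    using a p r by (intro finsum_cong') (auto simp: m_assoc mem_upD)
  also have "\<dots> = a \<otimes> mlt p r n"
    using a p r by (subst finsum_rdistr[symmetric]) (auto simp: mult_eq[OF p r N] mem_upD)
  finally show "mlt (\<lambda>n. a \<otimes> p n) r n = a \<otimes> mlt p r n" .
qed

lemma mult_zero_left: "mlt (\<lambda>n. \<zero>) r = (\<lambda>n. \<zero>)"
  by (simp add: ore_mult_def)

lemma mult_finsum_left:
  assumes "finite F" "\<And>i. i \<in> F \<Longrightarrow> f i \<in> up R" "r \<in> up R"
  shows "mlt (\<lambda>n. \<Oplus>i\<in>F. f i n) r = (\<lambda>n. \<Oplus>i\<in>F. mlt (f i) r n)"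
  using assms
proof (induction F rule: finite_induct)
  case empty
  show ?case by (simp add: mult_zero_left)
next
  case (insert k F)
  have "(\<lambda>n. \<Oplus>i\<in>insert k F. f i n) = (\<lambda>n. f k n \<oplus> (\<Oplus>i\<in>F. f i n))"
    using insert by (subst finsum_insert) (auto intro: mem_upD)
  then have "mlt (\<lambda>n. \<Oplus>i\<in>insert k F. f i n) r
      = (\<lambda>n. mlt (f k) r n \<oplus> mlt (\<lambda>n. \<Oplus>i\<in>F. f i n) r n)"
    using insert mult_add_left[of "f k" "\<lambda>n. \<Oplus>i\<in>F. f i n" r] up_finsum[of F f] by auto
  also have "\<dots> = (\<lambda>n. \<Oplus>i\<in>insert k F. mlt (f i) r n)"
    using insert by (subst finsum_insert) (auto intro: mem_upD)
  finally show ?case .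
qed

lemma X_finsum:
  assumes "finite F" "\<And>i. i \<in> F \<Longrightarrow> f i \<in> up R"
  shows "xop (\<lambda>n. \<Oplus>i\<in>F. f i n) = (\<lambda>n. \<Oplus>i\<in>F. xop (f i) n)"
  using assms
proof (induction F rule: finite_induct)
  case empty
  show ?case by (auto simp: ore_x_def fun_eq_iff split: nat.splits)
next
  case (insert k F)
  have "(\<lambda>n. \<Oplus>i\<in>insert k F. f i n) = (\<lambda>n. f k n \<oplus> (\<Oplus>i\<in>F. f i n))"
    using insert by (subst finsum_insert) (auto intro: mem_upD)
  then have "xop (\<lambda>n. \<Oplus>i\<in>insert k F. f i n) = (\<lambda>n. xop (f k) n \<oplus> xop (\<lambda>n. \<Oplus>i\<in>F. f i n) n)"
    using insert X_add[of "f k" "\<lambda>n. \<Oplus>i\<in>F. f i n"] up_finsum[of F f] by auto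
  also have "\<dots> = (\<lambda>n. \<Oplus>i\<in>insert k F. xop (f i) n)"
    using insert by (subst finsum_insert) (auto intro: mem_upD)
  finally show ?case .
qed

lemma X_mult:
  assumes p: "p \<in> up R" and r: "r \<in> up R"
  shows "xop (mlt p r) = mlt (xop p) r"
proof
  fix n
  obtain N where N: "\<And>i. N < i \<Longrightarrow> p i = \<zero>" using up_common_bound[OF p p] by metis
  define c where "c i = (xop ^^ i) r n" for i
  have c [simp, intro]: "c i \<in> carrier R" for i using r by (simp add: c_def)
  have pc [simp, intro]: "p i \<in> carrier R" for i using p by auto
  have "mlt p r = (\<lambda>n. \<Oplus>i\<in>{..N}. p i \<otimes> (xop ^^ i) r n)"
    using mult_eq[OF p r N] by auto
  then have "xop (mlt p r) n = (\<Oplus>i\<in>{..N}. xop (\<lambda>n. p i \<otimes> (xop ^^ i) r n) n)"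
    using X_finsum[of "{..N}" "\<lambda>i n. p i \<otimes> (xop ^^ i) r n"] r by (auto simp: up_smult_closed)
  also have "\<dots> = (\<Oplus>i\<in>{..N}. \<sigma> (p i) \<otimes> c (Suc i) \<oplus> \<delta> (p i) \<otimes> c i)"
    using r by (simp add: X_smult c_def)
  also have "\<dots> = (\<Oplus>i\<in>{..N}. \<sigma> (p i) \<otimes> c (Suc i)) \<oplus> (\<Oplus>i\<in>{..N}. \<delta> (p i) \<otimes> c i)"
    by (rule finsum_addf) auto
  also have "(\<Oplus>i\<in>{..N}. \<sigma> (p i) \<otimes> c (Suc i))
      = (\<Oplus>i\<in>{..Suc N}. (case i of 0 \<Rightarrow> \<zero> | Suc m \<Rightarrow> \<sigma> (p m)) \<otimes> c i)"
    by (subst finsum_Suc2) (auto split: nat.splits)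
  also have "(\<Oplus>i\<in>{..N}. \<delta> (p i) \<otimes> c i) = (\<Oplus>i\<in>{..Suc N}. \<delta> (p i) \<otimes> c i)"
    using N[of "Suc N"] by (subst finsum_Suc) auto
  also have "(\<Oplus>i\<in>{..Suc N}. (case i of 0 \<Rightarrow> \<zero> | Suc m \<Rightarrow> \<sigma> (p m)) \<otimes> c i) \<oplus>
      (\<Oplus>i\<in>{..Suc N}. \<delta> (p i) \<otimes> c i)
      = (\<Oplus>i\<in>{..Suc N}. (case i of 0 \<Rightarrow> \<zero> | Suc m \<Rightarrow> \<sigma> (p m)) \<otimes> c i \<oplus> \<delta> (p i) \<otimes> c i)"
    by (rule finsum_addf[symmetric]) (auto split: nat.splits)
  also have "\<dots> = (\<Oplus>i\<in>{..Suc N}. xop p i \<otimes> c i)"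
    by (rule finsum_cong') (auto simp: ore_x_def l_distr split: nat.splits)
  also have "\<dots> = mlt (xop p) r n"
    unfolding c_def
  proof (rule mult_eq[symmetric])
    show "xop p i = \<zero>" if "Suc N < i" for i
      using that N[of i] N[of "i - 1"] by (cases i) (auto simp: ore_x_def)
  qed (use p r in auto)
  finally show "xop (mlt p r) n = mlt (xop p) r n" .
qed

lemma Xpow_mult:
  assumes "p \<in> up R" "r \<in> up R"
  shows "(xop ^^ i) (mlt p r) = mlt ((xop ^^ i) p) r"
  using assms by (induction i) (simp_all add: X_mult)

lemma mult_assoc:
  assumes p: "p \<in> up R" and q: "q \<in> up R" and r: "r \<in> up R"
  shows "mlt (mlt p q) r = mlt p (mlt q r)"
proof
  fix n
  obtain N where N: "\<And>i. N < i \<Longrightarrow> p i = \<zero>" using up_common_bound[OF p p] by metis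
  have pc [simp, intro]: "p i \<in> carrier R" for i using p by auto
  have "mlt p q = (\<lambda>n. \<Oplus>i\<in>{..N}. p i \<otimes> (xop ^^ i) q n)"
    using mult_eq[OF p q N] by auto
  then have "mlt (mlt p q) r n = mlt (\<lambda>n. \<Oplus>i\<in>{..N}. p i \<otimes> (xop ^^ i) q n) r n"
    by (simp only:)
  also have "\<dots> = (\<Oplus>i\<in>{..N}. mlt (\<lambda>n. p i \<otimes> (xop ^^ i) q n) r n)"
    using q r by (subst mult_finsum_left) (simp_all add: up_smult_closed)
  also have "\<dots> = (\<Oplus>i\<in>{..N}. p i \<otimes> (xop ^^ i) (mlt q r) n)"
    using q r by (simp add: mult_smult_left Xpow_mult)
  also have "\<dots> = mlt p (mlt q r) n"
    by (rule mult_eq[OF p mult_closed[OF q r] N, symmetric])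
  finally show "mlt (mlt p q) r n = mlt p (mlt q r) n" .
qed

lemma Xpow_one:
  "(xop ^^ i) (\<lambda>n. if n = 0 then \<one> else \<zero>) = (\<lambda>n. if n = i then \<one> else \<zero>)"
proof (induction i)
  case (Suc i)
  have "(xop ^^ Suc i) (\<lambda>n. if n = 0 then \<one> else \<zero>) = xop (\<lambda>n. if n = i then \<one> else \<zero>)"
    using Suc.IH by simp
  also have "\<dots> = (\<lambda>n. if n = Suc i then \<one> else \<zero>)"
  proof
    show "xop (\<lambda>n. if n = i then \<one> else \<zero>) n = (if n = Suc i then \<one> else \<zero>)" for n
      by (cases n) (auto simp: ore_x_def)
  qed
  finally show ?case .
qed simp

lemma mult_one_left:
  assumes "q \<in> up R" shows "mlt (\<lambda>n. if n = 0 then \<one> else \<zero>) q = q"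
proof
  fix n
  have "mlt (\<lambda>n. if n = 0 then \<one> else \<zero>) q n
      = (\<Oplus>i\<in>{..0}. (if i = 0 then \<one> else \<zero>) \<otimes> (xop ^^ i) q n)"
    using assms by (intro mult_eq) (auto simp: up_one_closed)
  then show "mlt (\<lambda>n. if n = 0 then \<one> else \<zero>) q n = q n"
    using mem_upD[OF assms] by simp
qed

lemma mult_one_right:
  assumes "q \<in> up R" shows "mlt q (\<lambda>n. if n = 0 then \<one> else \<zero>) = q"
proof
  fix n
  obtain N where N: "\<And>i. N < i \<Longrightarrow> q i = \<zero>" using up_common_bound[OF assms assms] by metis
  have qc [simp, intro]: "q i \<in> carrier R" for i using assms by auto
  have "mlt q (\<lambda>n. if n = 0 then \<one> else \<zero>) n
      = (\<Oplus>i\<in>{..max N n}. q i \<otimes> (xop ^^ i) (\<lambda>n. if n = 0 then \<one> else \<zero>) n)"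
    using assms N by (intro mult_eq) (auto simp: up_one_closed)
  also have "\<dots> = (\<Oplus>i\<in>{..max N n}. if n = i then q i else \<zero>)"
    by (rule finsum_cong') (auto simp: Xpow_one)
  also have "\<dots> = q n"
    by (rule finsum_singleton) auto
  finally show "mlt q (\<lambda>n. if n = 0 then \<one> else \<zero>) n = q n" .
qed

theorem ore_extension_ring: "ring (ore_extension R \<sigma> \<delta>)"
proof (rule ringI)
  note [simp] = ore_extension_def
  show "abelian_group (ore_extension R \<sigma> \<delta>)"
  proof (rule abelian_groupI)
    show "\<zero>\<^bsub>ore_extension R \<sigma> \<delta>\<^esub> \<in> carrier (ore_extension R \<sigma> \<delta>)"
      by (auto simp: up_def)
  next
    fix p q r
    assume "p \<in> carrier (ore_extension R \<sigma> \<delta>)" "q \<in> carrier (ore_extension R \<sigma> \<delta>)"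
      "r \<in> carrier (ore_extension R \<sigma> \<delta>)"
    then show "p \<oplus>\<^bsub>ore_extension R \<sigma> \<delta>\<^esub> q \<oplus>\<^bsub>ore_extension R \<sigma> \<delta>\<^esub> r =
        p \<oplus>\<^bsub>ore_extension R \<sigma> \<delta>\<^esub> (q \<oplus>\<^bsub>ore_extension R \<sigma> \<delta>\<^esub> r)"
      by (simp add: a_assoc mem_upD)
  next
    fix p q
    assume "p \<in> carrier (ore_extension R \<sigma> \<delta>)" "q \<in> carrier (ore_extension R \<sigma> \<delta>)"
    then show "p \<oplus>\<^bsub>ore_extension R \<sigma> \<delta>\<^esub> q = q \<oplus>\<^bsub>ore_extension R \<sigma> \<delta>\<^esub> p"
      by (simp add: a_comm mem_upD)
  next
    fix p assume "p \<in> carrier (ore_extension R \<sigma> \<delta>)"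
    then have p: "p \<in> up R" by simp
    then show "\<exists>q\<in>carrier (ore_extension R \<sigma> \<delta>).
        q \<oplus>\<^bsub>ore_extension R \<sigma> \<delta>\<^esub> p = \<zero>\<^bsub>ore_extension R \<sigma> \<delta>\<^esub>"
      by (intro bexI[of _ "\<lambda>n. \<ominus> p n"]) (simp_all add: up_a_inv_closed l_neg mem_upD)
  qed (simp_all add: up_add_closed mem_upD)
  show "monoid (ore_extension R \<sigma> \<delta>)"
  proof (rule monoidI)
    fix p q r
    assume "p \<in> carrier (ore_extension R \<sigma> \<delta>)" "q \<in> carrier (ore_extension R \<sigma> \<delta>)"
      "r \<in> carrier (ore_extension R \<sigma> \<delta>)"
    then show "p \<otimes>\<^bsub>ore_extension R \<sigma> \<delta>\<^esub> q \<otimes>\<^bsub>ore_extension R \<sigma> \<delta>\<^esub> r =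
        p \<otimes>\<^bsub>ore_extension R \<sigma> \<delta>\<^esub> (q \<otimes>\<^bsub>ore_extension R \<sigma> \<delta>\<^esub> r)"
      by (simp add: mult_assoc)
  next
    fix p assume "p \<in> carrier (ore_extension R \<sigma> \<delta>)"
    then have p: "p \<in> up R" by simp
    show "\<one>\<^bsub>ore_extension R \<sigma> \<delta>\<^esub> \<otimes>\<^bsub>ore_extension R \<sigma> \<delta>\<^esub> p = p"
      by (simp add: mult_one_left[OF p])
    show "p \<otimes>\<^bsub>ore_extension R \<sigma> \<delta>\<^esub> \<one>\<^bsub>ore_extension R \<sigma> \<delta>\<^esub> = p"
      by (simp add: mult_one_right[OF p])
  qed (simp_all add: up_one_closed)
qed (simp_all add: ore_extension_def mult_add_left mult_add_right)

theorem ore_extension_commutation: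
  assumes a: "a \<in> carrier R"
  shows "monom (UP R) \<one> 1 \<otimes>\<^bsub>ore_extension R \<sigma> \<delta>\<^esub> monom (UP R) a 0
    = monom (UP R) (\<sigma> a) 0 \<otimes>\<^bsub>ore_extension R \<sigma> \<delta>\<^esub> monom (UP R) \<one> 1
      \<oplus>\<^bsub>ore_extension R \<sigma> \<delta>\<^esub> monom (UP R) (\<delta> a) 0"
proof -
  let ?e = "\<lambda>n::nat. if n = 0 then \<one> else \<zero>"
  have m: "monom (UP R) b k = (\<lambda>n. if n = k then b else \<zero>)" if "b \<in> carrier R" for b k
    using that by (simp add: UP_def)
  have up: "(\<lambda>n. if n = k then b else \<zero>) \<in> up R" if "b \<in> carrier R" for b and k :: nat
    using that by (auto simp: up_def intro!: exI[of _ k])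
  have x: "monom (UP R) \<one> 1 = xop ?e" using Xpow_one[of 1] by (simp add: m)
  have "mlt (xop ?e) (\<lambda>n. if n = 0 then a else \<zero>) = xop (\<lambda>n. if n = 0 then a else \<zero>)"
    using a up[of a 0] by (subst X_mult[symmetric]) (simp_all add: up_one_closed mult_one_left)
  moreover have "mlt (\<lambda>n. if n = 0 then \<sigma> a else \<zero>) (xop ?e) = (\<lambda>n. \<sigma> a \<otimes> xop ?e n)"
  proof -
    have "(\<lambda>n::nat. if n = 0 then \<sigma> a else \<zero>) = (\<lambda>n. \<sigma> a \<otimes> ?e n)" using a by auto
    then show ?thesis
      using a mult_smult_left[of "\<sigma> a" ?e "xop ?e"]
      by (simp add: up_one_closed mult_one_left)
  qed
  moreover have "xop (\<lambda>n. if n = 0 then a else \<zero>)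
      = (\<lambda>n. \<sigma> a \<otimes> xop ?e n \<oplus> (if n = 0 then \<delta> a else \<zero>))"
    using a by (auto simp: ore_x_def fun_eq_iff split: nat.splits)
  ultimately show ?thesis
    using a by (simp add: x[simplified] m[OF a] m[of "\<sigma> a"] m[of "\<delta> a"] ore_extension_def)
qed

end

end

(* Call u good if R u is uniform and meets the left annihilator of u trivially.
   In a semiprime left Goldie ring, which is left nonsingular, every nonzero left ideal contains a
   good element, so there are good u_0, ..., u_(n-1) with u_j u_i = 0 for i < j and zero common left
   annihilator.  Right multiplication by the u_i embeds R in the direct sum of the n uniform left
   ideals R u_i; hence udim R = n, and more generally R^K has no more than K n independent vectors.
   Counting in the free left R-module of the polynomials of degree < K, for large K, bounds the
   uniform dimension of S = R[x; sigma, delta] by n, and the same count shows that f u u = 0 implies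
   f u = 0 for f in S and u good.  So the S u_i are independent.
   For the Jordan extension A, a power of the automorphism moves finitely many elements of A into R,
   which gives the upper bound; the lower bound is the above cancellation in R[x; sigma], applied
   to f = r x^N. *)

theory Submission
  imports Defs
begin

text \<open>Two devices replace them. Nonsingularity gives, for each nonzero y, some s \<noteq> 0
  such that R s meets the left annihilator of y trivially; when y is the leading coefficient of x^j
  g, the multiples r s x^j g with r s \<noteq> 0 keep the full degree, as over a domain. Replacing
  elements by such nonzero left multiples is harmless in a count of independent elements. The second
  device turns a failure of cancellation into one independent vector too many. The squares in the
  cancellation come from the one-sided relations u_j u_i = 0 for i < j: multiplying a sum of terms
  f_j u_j on the right by u_i removes the later terms, but leaves f_i u_i u_i instead of f_i
  u_i.\<close>

text \<open>The products \<open>r i \<otimes> v i\<close> vanish, not the \<open>r i\<close>: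
  nonzero elements may have left annihilators, so the notion is directness of a sum of principal
  left ideals, not freeness.\<close>

definition independent_elements :: "('a, 'm) ring_scheme \<Rightarrow> nat \<Rightarrow> (nat \<Rightarrow> 'a) \<Rightarrow> bool" where
  "independent_elements R p v \<longleftrightarrow>
     (\<forall>i<p. v i \<in> carrier R \<and> v i \<noteq> \<zero>\<^bsub>R\<^esub>) \<and>
     (\<forall>r. (\<forall>i<p. r i \<in> carrier R) \<and> (\<Oplus>\<^bsub>R\<^esub>i\<in>{..<p}. r i \<otimes>\<^bsub>R\<^esub> v i) = \<zero>\<^bsub>R\<^esub> \<longrightarrow>
        (\<forall>i<p. r i \<otimes>\<^bsub>R\<^esub> v i = \<zero>\<^bsub>R\<^esub>))"

text \<open>Elementwise: the left annihilator of \<open>z\<close> is an essential left ideal.\<close>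

definition left_singular :: "('a, 'm) ring_scheme \<Rightarrow> 'a \<Rightarrow> bool" where
  "left_singular R z \<longleftrightarrow> z \<in> carrier R \<and>
     (\<forall>x\<in>carrier R. x \<noteq> \<zero>\<^bsub>R\<^esub> \<longrightarrow> (\<exists>r\<in>carrier R. r \<otimes>\<^bsub>R\<^esub> x \<noteq> \<zero>\<^bsub>R\<^esub> \<and> r \<otimes>\<^bsub>R\<^esub> x \<otimes>\<^bsub>R\<^esub> z = \<zero>\<^bsub>R\<^esub>))"

text \<open>Uniformity is expressed by common nonzero multiples, the form in which elimination of a
  coordinate uses it.\<close>

definition uniform_element :: "('a, 'm) ring_scheme \<Rightarrow> 'a \<Rightarrow> bool" where
  "uniform_element R x \<longleftrightarrow> x \<in> carrier R \<and> x \<noteq> \<zero>\<^bsub>R\<^esub> \<and>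
     (\<forall>r\<in>carrier R. \<forall>s\<in>carrier R. r \<otimes>\<^bsub>R\<^esub> x \<noteq> \<zero>\<^bsub>R\<^esub> \<longrightarrow> s \<otimes>\<^bsub>R\<^esub> x \<noteq> \<zero>\<^bsub>R\<^esub> \<longrightarrow>
        (\<exists>a\<in>carrier R. \<exists>b\<in>carrier R. a \<otimes>\<^bsub>R\<^esub> (r \<otimes>\<^bsub>R\<^esub> x) = b \<otimes>\<^bsub>R\<^esub> (s \<otimes>\<^bsub>R\<^esub> x) \<and> a \<otimes>\<^bsub>R\<^esub> (r \<otimes>\<^bsub>R\<^esub> x) \<noteq> \<zero>\<^bsub>R\<^esub>))"

definition good_element :: "('a, 'm) ring_scheme \<Rightarrow> 'a \<Rightarrow> bool" where
  "good_element R u \<longleftrightarrow> uniform_element R u \<and>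
     (\<forall>r\<in>carrier R. r \<otimes>\<^bsub>R\<^esub> u \<otimes>\<^bsub>R\<^esub> u = \<zero>\<^bsub>R\<^esub> \<longrightarrow> r \<otimes>\<^bsub>R\<^esub> u = \<zero>\<^bsub>R\<^esub>)"

text \<open>Products vanish on one side only, because a new member is a left multiple of some
  \<open>x\<close> with \<open>x \<otimes> u i = \<zero>\<close> for the earlier \<open>u i\<close>;
  nothing controls \<open>u i \<otimes> x\<close>.\<close>

definition good_system :: "('a, 'm) ring_scheme \<Rightarrow> nat \<Rightarrow> (nat \<Rightarrow> 'a) \<Rightarrow> bool" where
  "good_system R n u \<longleftrightarrow>
     (\<forall>i<n. good_element R (u i)) \<and> (\<forall>j<n. \<forall>i<j. u j \<otimes>\<^bsub>R\<^esub> u i = \<zero>\<^bsub>R\<^esub>)"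

definition complete_system :: "('a, 'm) ring_scheme \<Rightarrow> nat \<Rightarrow> (nat \<Rightarrow> 'a) \<Rightarrow> bool" where
  "complete_system R n u \<longleftrightarrow> good_system R n u \<and>
     (\<forall>r\<in>carrier R. (\<forall>i<n. r \<otimes>\<^bsub>R\<^esub> u i = \<zero>\<^bsub>R\<^esub>) \<longrightarrow> r = \<zero>\<^bsub>R\<^esub>)"

section \<open>Left ideals, finite sums, and uniform dimension in terms of elements\<close>

context ring
begin

lemma left_idealI:
  assumes "I \<subseteq> carrier R" "\<zero> \<in> I" "\<And>a b. a \<in> I \<Longrightarrow> b \<in> I \<Longrightarrow> a \<oplus> b \<in> I"
    and "\<And>r a. r \<in> carrier R \<Longrightarrow> a \<in> I \<Longrightarrow> r \<otimes> a \<in> I"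
  shows "left_ideal I R"
  unfolding left_ideal_def
proof (intro conjI ballI)
  show "additive_subgroup I R"
  proof (intro additive_subgroupI add.subgroupI)
    show "\<ominus> a \<in> I" if "a \<in> I" for a
      using assms(4)[of "\<ominus> \<one>" a] that assms(1) by (auto simp: l_minus)
  qed (use assms in auto)
qed (use assms in auto)

lemma left_ideal_principal:
  assumes "x \<in> carrier R" shows "left_ideal {r \<otimes> x | r. r \<in> carrier R} R"
proof (rule left_idealI)
  show "\<zero> \<in> {r \<otimes> x |r. r \<in> carrier R}"
    using assms by (intro CollectI exI[of _ \<zero>]) auto
  fix a b assume "a \<in> {r \<otimes> x | r. r \<in> carrier R}" "b \<in> {r \<otimes> x | r. r \<in> carrier R}"
  then obtain r s where "r \<in> carrier R" "s \<in> carrier R" "a = r \<otimes> x" "b = s \<otimes> x" by auto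
  then show "a \<oplus> b \<in> {r \<otimes> x | r. r \<in> carrier R}"
    using assms by (intro CollectI exI[of _ "r \<oplus> s"]) (auto simp: l_distr)
next
  fix r a assume "r \<in> carrier R" "a \<in> {r \<otimes> x | r. r \<in> carrier R}"
  then obtain s where "s \<in> carrier R" "a = s \<otimes> x" by auto
  then show "r \<otimes> a \<in> {r \<otimes> x | r. r \<in> carrier R}"
    using assms \<open>r \<in> carrier R\<close> by (intro CollectI exI[of _ "r \<otimes> s"]) (auto simp: m_assoc)
qed (use assms in auto)

lemma left_ideal_closed:
  assumes "left_ideal I R"
  shows "\<And>a. a \<in> I \<Longrightarrow> a \<in> carrier R" "\<zero> \<in> I"
    and "\<And>a b. a \<in> I \<Longrightarrow> b \<in> I \<Longrightarrow> a \<ominus> b \<in> I"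
    and "\<And>r a. r \<in> carrier R \<Longrightarrow> a \<in> I \<Longrightarrow> r \<otimes> a \<in> I"
proof -
  interpret additive_subgroup I R using assms by (simp add: left_ideal_def)
  show "\<And>a. a \<in> I \<Longrightarrow> a \<in> carrier R" "\<zero> \<in> I" "\<And>a b. a \<in> I \<Longrightarrow> b \<in> I \<Longrightarrow> a \<ominus> b \<in> I"
    by (auto simp: a_minus_def)
  show "\<And>r a. r \<in> carrier R \<Longrightarrow> a \<in> I \<Longrightarrow> r \<otimes> a \<in> I"
    using assms by (simp add: left_ideal_def)
qed

lemma finsum_eq_single:
  assumes "finite A" "i \<in> A" "f i \<in> carrier R" "\<And>j. j \<in> A \<Longrightarrow> j \<noteq> i \<Longrightarrow> f j = \<zero>"
  shows "(\<Oplus>j\<in>A. f j) = f i"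
proof -
  have "(\<Oplus>j\<in>A. f j) = (\<Oplus>j\<in>insert i (A - {i}). f j)"
    using assms(2) by (simp add: insert_absorb)
  also have "\<dots> = f i \<oplus> (\<Oplus>j\<in>A - {i}. f j)"
    using assms by (intro finsum_insert) auto
  also have "(\<Oplus>j\<in>A - {i}. f j) = \<zero>"
    using assms by (intro add.finprod_one_eqI) auto
  finally show ?thesis using assms(3) by simp
qed

lemma finsum_Times:
  assumes "finite A" "finite B" "\<And>q. q \<in> A \<times> B \<Longrightarrow> f q \<in> carrier R"
  shows "(\<Oplus>q\<in>A \<times> B. f q) = (\<Oplus>j\<in>B. \<Oplus>i\<in>A. f (i, j))"
proof -
  have "(\<Oplus>q\<in>A \<times> B. f q) = (\<Oplus>q\<in>(\<Union>j\<in>B. A \<times> {j}). f q)"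
    by (rule arg_cong[where f = "finsum R f"]) auto
  also have "\<dots> = (\<Oplus>j\<in>B. \<Oplus>q\<in>A \<times> {j}. f q)"
    using assms by (intro add.finprod_UN_disjoint) (auto simp: pairwise_def disjnt_def)
  also have "\<dots> = (\<Oplus>j\<in>B. \<Oplus>i\<in>A. f (i, j))"
  proof (rule finsum_cong')
    fix j assume j: "j \<in> B"
    have "(\<Oplus>q\<in>(\<lambda>i. (i, j)) ` A. f q) = (\<Oplus>i\<in>A. f (i, j))"
      using assms j by (subst finsum_reindex) (auto simp: inj_on_def)
    moreover have "(\<lambda>i. (i, j)) ` A = A \<times> {j}" by auto
    ultimately show "(\<Oplus>q\<in>A \<times> {j}. f q) = (\<Oplus>i\<in>A. f (i, j))" by simp
  qed (use assms in auto)
  finally show ?thesis .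
qed

lemma udim_ge:
  assumes "independent_elements R p v" shows "enat p \<le> udim R"
proof -
  define I where "I k = {r \<otimes> v k | r. r \<in> carrier R}" for k
  have v: "v k \<in> carrier R" "v k \<noteq> \<zero>" if "k < p" for k
    using assms that by (auto simp: independent_elements_def)
  have "left_ideal (I k) R \<and> I k \<noteq> {\<zero>}" if "k < p" for k
  proof
    show "left_ideal (I k) R" unfolding I_def using v that by (intro left_ideal_principal) auto
    have "v k \<in> I k" using v[OF that] by (auto simp: I_def intro!: exI[of _ \<one>])
    then show "I k \<noteq> {\<zero>}" using v that by auto
  qed
  moreover have "independent_family R p I"
    unfolding independent_family_def
  proof (intro allI impI)
    fix a k assume a: "(\<forall>k<p. a k \<in> I k) \<and> (\<Oplus>k\<in>{..<p}. a k) = \<zero>" and k: "k < p"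
    obtain r where r: "r k \<in> carrier R" "a k = r k \<otimes> v k" if "k < p" for k
      using a unfolding I_def by atomize_elim (simp, metis)
    have "(\<Oplus>k\<in>{..<p}. r k \<otimes> v k) = (\<Oplus>k\<in>{..<p}. a k)"
      using r v by (intro finsum_cong') auto
    then show "a k = \<zero>"
      using assms a k r unfolding independent_elements_def by metis
  qed
  ultimately show ?thesis
    unfolding udim_def by (intro Sup_upper) auto
qed

text \<open>Picking a nonzero element from each left ideal of a direct family keeps the sum direct,
  so principal left ideals decide the supremum.\<close>

lemma udim_le:
  assumes "\<And>p v. independent_elements R p v \<Longrightarrow> p \<le> n" shows "udim R \<le> enat n"
  unfolding udim_def
proof (rule Sup_least, clarify)
  fix p I assume I: "\<forall>k<p. left_ideal (I k) R \<and> I k \<noteq> {\<zero>}" and ind: "independent_family R p I"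
  have "\<exists>x. x \<in> I k \<and> x \<noteq> \<zero>" if "k < p" for k
    using I that left_ideal_closed(2) by blast
  then obtain v where v: "v k \<in> I k" "v k \<noteq> \<zero>" if "k < p" for k by metis
  have "independent_elements R p v"
    unfolding independent_elements_def
  proof (intro conjI allI impI)
    show "v k \<in> carrier R" "v k \<noteq> \<zero>" if "k < p" for k
      using v I left_ideal_closed(1) that by blast+
    fix r i assume r: "(\<forall>i<p. r i \<in> carrier R) \<and> (\<Oplus>i\<in>{..<p}. r i \<otimes> v i) = \<zero>" and "i < p"
    moreover have "r k \<otimes> v k \<in> I k" if "k < p" for k
      using left_ideal_closed(4) I r v that by blast
    ultimately show "r i \<otimes> v i = \<zero>"
      using ind[unfolded independent_family_def, rule_format, of "\<lambda>i. r i \<otimes> v i" i] by auto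
  qed
  then show "enat p \<le> enat n" using assms by auto
qed

text \<open>Right multiplication by \<open>w i\<close> removes the terms before \<open>i\<close> by
  induction and those after \<open>i\<close> by \<open>tri\<close>. The cancellation
  \<open>sq\<close> is asked for the given \<open>f\<close> only: the proof of cancellation in the
  Ore extension applies this to special coefficients, before cancellation is known in
  general.\<close>

lemma triangular_sum_zero:
  fixes n :: nat
  assumes w: "\<And>i. i < n \<Longrightarrow> w i \<in> carrier R" and f: "\<And>i. i < n \<Longrightarrow> f i \<in> carrier R"
    and tri: "\<And>i j. j < n \<Longrightarrow> i < j \<Longrightarrow> w j \<otimes> w i = \<zero>"
    and sq: "\<And>i. i < n \<Longrightarrow> f i \<otimes> w i \<otimes> w i = \<zero> \<Longrightarrow> f i \<otimes> w i = \<zero>"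
    and sum: "(\<Oplus>i\<in>{..<n}. f i \<otimes> w i) = \<zero>"
  shows "i < n \<Longrightarrow> f i \<otimes> w i = \<zero>"
proof (induction i rule: less_induct)
  case (less i)
  have "(\<Oplus>j\<in>{..<n}. f j \<otimes> w j \<otimes> w i) = (\<Oplus>j\<in>{..<n}. f j \<otimes> w j) \<otimes> w i"
    using less.prems w f by (subst finsum_ldistr) auto
  also have "\<dots> = \<zero>" using sum w less.prems by simp
  also have "(\<Oplus>j\<in>{..<n}. f j \<otimes> w j \<otimes> w i) = f i \<otimes> w i \<otimes> w i"
  proof (rule finsum_eq_single)
    fix j assume j: "j \<in> {..<n}" "j \<noteq> i"
    show "f j \<otimes> w j \<otimes> w i = \<zero>"
    proof (cases "j < i")
      case True
      then show ?thesis using less.IH j w less.prems by simp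
    next
      case False
      then have "w j \<otimes> w i = \<zero>" using tri j by simp
      then show ?thesis using w f j less.prems by (simp add: m_assoc)
    qed
  qed (use less.prems w f in auto)
  finally show ?case using sq less.prems by simp
qed

lemma triangular_independent:
  assumes "\<And>i. i < n \<Longrightarrow> w i \<in> carrier R" "\<And>i. i < n \<Longrightarrow> w i \<noteq> \<zero>"
    and "\<And>i j. j < n \<Longrightarrow> i < j \<Longrightarrow> w j \<otimes> w i = \<zero>"
    and "\<And>i r. i < n \<Longrightarrow> r \<in> carrier R \<Longrightarrow> r \<otimes> w i \<otimes> w i = \<zero> \<Longrightarrow> r \<otimes> w i = \<zero>"
  shows "independent_elements R n w"
  unfolding independent_elements_def
proof (intro conjI allI impI)
  fix r i assume r: "(\<forall>i<n. r i \<in> carrier R) \<and> (\<Oplus>i\<in>{..<n}. r i \<otimes> w i) = \<zero>" and "i < n"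
  then show "r i \<otimes> w i = \<zero>"
    using triangular_sum_zero[of n w r i] assms by blast
qed (use assms in auto)

section \<open>Singular elements of semiprime rings\<close>

text \<open>The left annihilator of \<open>t \<otimes> z\<close> is the preimage of that of
  \<open>z\<close> under right multiplication by \<open>t\<close>, and preimages of essential left
  ideals are essential.\<close>

lemma left_singular_l_mult:
  assumes "left_singular R z" "t \<in> carrier R" shows "left_singular R (t \<otimes> z)"
  unfolding left_singular_def
proof (intro conjI ballI impI)
  have z: "z \<in> carrier R" using assms by (simp add: left_singular_def)
  then show "t \<otimes> z \<in> carrier R" using assms by simp
  fix x assume x: "x \<in> carrier R" "x \<noteq> \<zero>"
  show "\<exists>r\<in>carrier R. r \<otimes> x \<noteq> \<zero> \<and> r \<otimes> x \<otimes> (t \<otimes> z) = \<zero>"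
  proof (cases "x \<otimes> t = \<zero>")
    case True
    then have "x \<otimes> (t \<otimes> z) = \<zero>" using assms x z by (simp add: m_assoc[symmetric])
    then show ?thesis using x by (intro bexI[of _ \<one>]) auto
  next
    case False
    then obtain r where r: "r \<in> carrier R" "r \<otimes> (x \<otimes> t) \<noteq> \<zero>" "r \<otimes> (x \<otimes> t) \<otimes> z = \<zero>"
      using assms x by (auto simp: left_singular_def)
    moreover from r have "r \<otimes> x \<noteq> \<zero>" using x assms by (auto simp: m_assoc[symmetric])
    ultimately show ?thesis using x assms z by (intro bexI[of _ r]) (auto simp: m_assoc)
  qed
qed

text \<open>\<open>X\<close> is the left annihilator of \<open>R z\<close> and \<open>Y\<close> the
  right annihilator of \<open>X\<close>. Both are two-sided ideals containing \<open>z\<close>, or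
  at least containing it under \<open>zz\<close>, and \<open>X \<inter> Y\<close> has square zero by
  construction. No description of the ideal generated by \<open>z\<close> is required.\<close>

lemma semiprime_element:
  assumes "semiprime_ring R" and z: "z \<in> carrier R" and zz: "\<And>r. r \<in> carrier R \<Longrightarrow> z \<otimes> r \<otimes> z = \<zero>"
  shows "z = \<zero>"
proof -
  define X where "X = {a \<in> carrier R. \<forall>r\<in>carrier R. a \<otimes> r \<otimes> z = \<zero>}"
  define Y where "Y = {b \<in> carrier R. \<forall>a\<in>X. a \<otimes> b = \<zero>}"
  have Xc: "a \<in> carrier R" if "a \<in> X" for a using that by (simp add: X_def)
  have Xr: "a \<otimes> s \<in> X" if "a \<in> X" "s \<in> carrier R" for a s
  proof -
    have "a \<otimes> s \<otimes> r \<otimes> z = \<zero>" if r: "r \<in> carrier R" for r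
    proof -
      have "a \<otimes> (s \<otimes> r) \<otimes> z = \<zero>" using \<open>a \<in> X\<close> \<open>s \<in> carrier R\<close> r by (auto simp: X_def)
      then show ?thesis using Xc[OF \<open>a \<in> X\<close>] \<open>s \<in> carrier R\<close> r z by (simp add: m_assoc)
    qed
    then show ?thesis using that by (auto simp: X_def)
  qed
  have "ideal X R"
  proof (rule idealI[OF ring_axioms])
    show "subgroup X (add_monoid R)"
      using z by (intro add.subgroupI) (auto simp: X_def l_distr l_minus intro!: exI[of _ \<zero>])
    show "x \<otimes> a \<in> X" if "a \<in> X" "x \<in> carrier R" for a x
      using that z by (auto simp: X_def m_assoc)
  qed (rule Xr)
  moreover have "ideal Y R"
  proof (rule idealI[OF ring_axioms])
    show "subgroup Y (add_monoid R)"
      using Xc by (intro add.subgroupI) (auto simp: Y_def r_distr r_minus intro!: exI[of _ \<zero>])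
    show "a \<otimes> x \<in> Y" if "a \<in> Y" "x \<in> carrier R" for a x
      using that Xc by (auto simp: Y_def m_assoc[symmetric])
    show "x \<otimes> a \<in> Y" if "a \<in> Y" "x \<in> carrier R" for a x
      using that Xc Xr by (auto simp: Y_def m_assoc[symmetric])
  qed
  ultimately have id: "ideal (X \<inter> Y) R" by (rule i_intersect)
  have "c = \<zero>" if "c \<in> (X \<inter> Y) \<cdot> (X \<inter> Y)" for c
    using that by induction (auto simp: Y_def)
  moreover have "\<zero> \<in> X \<inter> Y"
    using additive_subgroup.zero_closed[OF ideal.axioms(1)[OF id]] .
  then have "\<zero> \<otimes> \<zero> \<in> (X \<inter> Y) \<cdot> (X \<inter> Y)" by (intro ideal_prod.prod)
  then have "\<zero> \<in> (X \<inter> Y) \<cdot> (X \<inter> Y)" by simp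
  ultimately have "(X \<inter> Y) \<cdot> (X \<inter> Y) = {\<zero>}" by blast
  with id have "X \<inter> Y = {\<zero>}" using assms(1)[unfolded semiprime_ring_def] by blast
  moreover have "a \<otimes> z = \<zero>" if "a \<in> X" for a
  proof -
    have "a \<otimes> \<one> \<otimes> z = \<zero>" using that unfolding X_def by blast
    then show ?thesis using Xc[OF that] by simp
  qed
  then have "z \<in> X \<inter> Y" using z zz by (auto simp: X_def Y_def)
  ultimately show ?thesis by auto
qed

text \<open>Otherwise dependent choice would produce a strictly ascending chain of left annihilators
  of single elements.\<close>

lemma acc_maximal_annihilator:
  assumes acc: "acc_left_annihilators R" and P: "P z" "\<And>x. P x \<Longrightarrow> x \<in> carrier R"
  shows "\<exists>y. P y \<and> (\<forall>x. P x \<longrightarrow> left_annihilator R {y} \<subseteq> left_annihilator R {x} \<longrightarrow>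
           left_annihilator R {x} = left_annihilator R {y})"
proof (rule ccontr)
  assume "\<not> ?thesis"
  then have step: "\<exists>x. P x \<and> left_annihilator R {y} \<subset> left_annihilator R {x}" if "P y" for y
    using that by blast
  obtain f where f: "\<And>n. P (f n)" "\<And>n. left_annihilator R {f n} \<subset> left_annihilator R {f (Suc n)}"
    using dependent_nat_choice[of "\<lambda>_. P" "\<lambda>_ y x. left_annihilator R {y} \<subset> left_annihilator R {x}"]
      P step by metis
  define L where "L n = left_annihilator R {f n}" for n
  have "mono L" using f(2) by (intro incseq_SucI) (auto simp: L_def)
  moreover have "\<exists>S\<subseteq>carrier R. L i = left_annihilator R S" for i
    using f P by (intro exI[of _ "{f i}"]) (auto simp: L_def)
  ultimately obtain n where "\<forall>m\<ge>n. L m = L n"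
    using acc[unfolded acc_left_annihilators_def] by meson
  then have "left_annihilator R {f (Suc n)} = left_annihilator R {f n}"
    unfolding L_def using le_SucI by blast
  then show False using f(2)[of n] by blast
qed

text \<open>Take a nonzero singular \<open>y\<close> with maximal left annihilator. If
  \<open>y \<otimes> r \<otimes> y\<close> were nonzero, it would have the same annihilator as
  \<open>y\<close>; but singularity of \<open>r \<otimes> y\<close> gives \<open>t\<close> with
  \<open>t \<otimes> y\<close> nonzero and \<open>t \<otimes> y \<otimes> r \<otimes> y\<close>
  zero. So \<open>y R y = 0\<close>, and semiprimeness applies.\<close>

lemma semiprime_acc_nonsingular:
  assumes sp: "semiprime_ring R" and acc: "acc_left_annihilators R" and z: "left_singular R z"
  shows "z = \<zero>"
proof (rule ccontr)
  assume "z \<noteq> \<zero>"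
  define P where "P x \<longleftrightarrow> left_singular R x \<and> x \<noteq> \<zero>" for x
  have Pc: "P x \<Longrightarrow> x \<in> carrier R" for x by (simp add: P_def left_singular_def)
  have "P z" using z \<open>z \<noteq> \<zero>\<close> by (simp add: P_def)
  from acc_maximal_annihilator[of P, OF acc this Pc] obtain y
    where y: "P y" and max: "\<And>x. P x \<Longrightarrow> left_annihilator R {y} \<subseteq> left_annihilator R {x} \<Longrightarrow>
           left_annihilator R {x} = left_annihilator R {y}"
    by blast
  have yc [simp]: "y \<in> carrier R" using Pc[OF y] .
  have "y \<otimes> r \<otimes> y = \<zero>" if r: "r \<in> carrier R" for r
  proof (rule ccontr)
    assume "y \<otimes> r \<otimes> y \<noteq> \<zero>"
    moreover have "left_singular R (y \<otimes> r \<otimes> y)"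
      using y r by (intro left_singular_l_mult) (auto simp: P_def)
    ultimately have "P (y \<otimes> r \<otimes> y)" by (simp add: P_def)
    moreover have "left_annihilator R {y} \<subseteq> left_annihilator R {y \<otimes> r \<otimes> y}"
      using r by (auto simp: left_annihilator_def m_assoc[symmetric])
    ultimately have eq: "left_annihilator R {y \<otimes> r \<otimes> y} = left_annihilator R {y}" by (rule max)
    have "left_singular R (r \<otimes> y)" using y r by (auto simp: P_def intro: left_singular_l_mult)
    then obtain t where t: "t \<in> carrier R" "t \<otimes> y \<noteq> \<zero>" "t \<otimes> y \<otimes> (r \<otimes> y) = \<zero>"
      using y by (auto simp: P_def left_singular_def)
    then have "t \<in> left_annihilator R {y \<otimes> r \<otimes> y}"
      using r by (auto simp: left_annihilator_def m_assoc)
    then show False using eq t by (auto simp: left_annihilator_def)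
  qed
  then have "y = \<zero>" using semiprime_element[OF sp yc] by blast
  then show False using y by (simp add: P_def)
qed

section \<open>Uniform elements\<close>

lemma uniform_element_mult:
  assumes "uniform_element R x" "t \<in> carrier R" "t \<otimes> x \<noteq> \<zero>"
  shows "uniform_element R (t \<otimes> x)"
  unfolding uniform_element_def
proof (intro conjI ballI impI)
  have x: "x \<in> carrier R" using assms by (simp add: uniform_element_def)
  show "t \<otimes> x \<in> carrier R" "t \<otimes> x \<noteq> \<zero>" using assms x by auto
  fix r s assume rs: "r \<in> carrier R" "s \<in> carrier R" and "r \<otimes> (t \<otimes> x) \<noteq> \<zero>" "s \<otimes> (t \<otimes> x) \<noteq> \<zero>"
  then have "r \<otimes> t \<otimes> x \<noteq> \<zero>" "s \<otimes> t \<otimes> x \<noteq> \<zero>" using assms x by (auto simp: m_assoc)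
  then have "\<exists>a\<in>carrier R. \<exists>b\<in>carrier R. a \<otimes> (r \<otimes> t \<otimes> x) = b \<otimes> (s \<otimes> t \<otimes> x) \<and> a \<otimes> (r \<otimes> t \<otimes> x) \<noteq> \<zero>"
    using assms(1)[unfolded uniform_element_def] rs assms(2) by (auto dest!: bspec[of _ _ "r \<otimes> t"] bspec[of _ _ "s \<otimes> t"])
  then show "\<exists>a\<in>carrier R. \<exists>b\<in>carrier R. a \<otimes> (r \<otimes> (t \<otimes> x)) = b \<otimes> (s \<otimes> (t \<otimes> x)) \<and> a \<otimes> (r \<otimes> (t \<otimes> x)) \<noteq> \<zero>"
    using assms rs x by (simp add: m_assoc)
qed

text \<open>If no left multiple of \<open>x\<close> is uniform, each nonzero multiple
  \<open>y\<close> has nonzero multiples \<open>r \<otimes> y\<close> and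
  \<open>s \<otimes> y\<close> that generate left ideals with zero intersection. Keeping the first
  and continuing inside the second gives direct sums of every length.\<close>

lemma uniform_element_exists:
  assumes fin: "udim R \<noteq> \<infinity>" and x: "x \<in> carrier R" "x \<noteq> \<zero>"
  shows "\<exists>t\<in>carrier R. uniform_element R (t \<otimes> x)"
proof (rule ccontr)
  assume none: "\<not> ?thesis"
  define N where "N y \<longleftrightarrow> y \<noteq> \<zero> \<and> (\<exists>t\<in>carrier R. y = t \<otimes> x)" for y
  have Nc: "y \<in> carrier R" if "N y" for y using that x by (auto simp: N_def)
  define step where "step y r s \<longleftrightarrow> r \<in> carrier R \<and> s \<in> carrier R \<and> r \<otimes> y \<noteq> \<zero> \<and>
    (\<forall>a\<in>carrier R. \<forall>b\<in>carrier R. a \<otimes> (r \<otimes> y) = b \<otimes> (s \<otimes> y) \<longrightarrow> a \<otimes> (r \<otimes> y) = \<zero>)" for y r s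
  have "\<exists>y'. N y' \<and> (\<exists>r s. step y r s \<and> y' = s \<otimes> y)" if y: "N y" for y
  proof -
    obtain t where t: "t \<in> carrier R" "y = t \<otimes> x" using y by (auto simp: N_def)
    then have "\<not> uniform_element R y" using none by auto
    then obtain r s where rs: "r \<in> carrier R" "s \<in> carrier R" "r \<otimes> y \<noteq> \<zero>" "s \<otimes> y \<noteq> \<zero>"
      "\<forall>a\<in>carrier R. \<forall>b\<in>carrier R. a \<otimes> (r \<otimes> y) = b \<otimes> (s \<otimes> y) \<longrightarrow> a \<otimes> (r \<otimes> y) = \<zero>"
      using Nc[OF y] y unfolding uniform_element_def N_def by blast
    then have "N (s \<otimes> y)"
      using t x unfolding N_def by (intro conjI bexI[of _ "s \<otimes> t"]) (auto simp: m_assoc)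
    then show ?thesis using rs unfolding step_def by blast
  qed
  moreover have "N x" using x unfolding N_def by (intro conjI bexI[of _ \<one>]) auto
  ultimately obtain y where y: "\<And>n. N (y n)" "\<And>n. \<exists>r s. step (y n) r s \<and> y (Suc n) = s \<otimes> y n"
    using dependent_nat_choice[of "\<lambda>_. N" "\<lambda>_ y y'. \<exists>r s. step y r s \<and> y' = s \<otimes> y"] by metis
  then obtain r s where rs: "\<And>n. step (y n) (r n) (s n)" "\<And>n. y (Suc n) = s n \<otimes> y n" by metis
  note [simp] = Nc[OF y(1)]
  have [simp]: "r n \<in> carrier R" "s n \<in> carrier R" for n using rs(1)[of n] by (auto simp: step_def)
  define v where "v n = r n \<otimes> y n" for n
  have v [simp]: "v n \<in> carrier R" "v n \<noteq> \<zero>" for n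
    using rs(1)[of n] by (auto simp: v_def step_def)
  \<comment> \<open>The terms after position \<open>k\<close> lie in \<open>R y (Suc k)\<close>,
    which meets \<open>R v k\<close> trivially; this lets the summands be split off from the
    front.\<close>
  have tail: "(\<Oplus>i\<in>{k..<p}. c i \<otimes> v i) \<in> {b \<otimes> y k | b. b \<in> carrier R}"
    if "k \<le> p" "\<And>i. i < p \<Longrightarrow> c i \<in> carrier R" for c k p
    using that
  proof (induction k rule: inc_induct)
    case base
    show ?case by (auto intro!: exI[of _ \<zero>])
  next
    case (step k)
    then obtain b where b: "b \<in> carrier R" "(\<Oplus>i\<in>{Suc k..<p}. c i \<otimes> v i) = b \<otimes> y (Suc k)" by auto
    have "{k..<p} = insert k {Suc k..<p}" using step.hyps by auto
    then have "(\<Oplus>i\<in>{k..<p}. c i \<otimes> v i) = c k \<otimes> v k \<oplus> b \<otimes> y (Suc k)"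
      using step.hyps step.prems b(2) by (auto simp: finsum_insert Pi_def)
    also have "\<dots> = (c k \<otimes> r k \<oplus> b \<otimes> s k) \<otimes> y k"
      using step.hyps step.prems b(1) by (simp add: v_def rs(2) l_distr m_assoc)
    finally show ?case using step.hyps step.prems b(1) by auto
  qed
  have "independent_elements R p v" for p
    unfolding independent_elements_def
  proof (intro conjI allI impI)
    fix c i assume c: "(\<forall>i<p. c i \<in> carrier R) \<and> (\<Oplus>i\<in>{..<p}. c i \<otimes> v i) = \<zero>" and "i < p"
    have "(\<Oplus>i\<in>{k..<p}. c i \<otimes> v i) = \<zero> \<and> (\<forall>i<k. c i \<otimes> v i = \<zero>)" if "k \<le> p" for k
      using that
    proof (induction k)
      case 0
      then show ?case using c by (simp add: atLeast0LessThan)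
    next
      case (Suc k)
      obtain b where b: "b \<in> carrier R" "(\<Oplus>i\<in>{Suc k..<p}. c i \<otimes> v i) = b \<otimes> y (Suc k)"
        using tail[of "Suc k" p c] Suc.prems c by auto
      have "{k..<p} = insert k {Suc k..<p}" using Suc.prems by auto
      then have eq: "c k \<otimes> v k \<oplus> b \<otimes> y (Suc k) = \<zero>"
        using Suc c b(2) by (auto simp: finsum_insert Pi_def)
      have ck: "c k \<in> carrier R" using c Suc.prems by auto
      have "c k \<otimes> v k = \<ominus> (b \<otimes> y (Suc k))"
        using eq ck b by (intro minus_equality[symmetric]) auto
      then have "c k \<otimes> (r k \<otimes> y k) = (\<ominus> b) \<otimes> (s k \<otimes> y k)"
        using b by (simp add: v_def rs(2) l_minus)
      then have 0: "c k \<otimes> v k = \<zero>"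
        using rs(1)[of k] ck b(1) unfolding step_def v_def by (meson a_inv_closed)
      then have "b \<otimes> y (Suc k) = \<zero>" using eq b by simp
      then show ?case using 0 Suc b(2) less_Suc_eq by auto
    qed
    from this[of p] show "c i \<otimes> v i = \<zero>" using \<open>i < p\<close> by auto
  qed auto
  then have "enat p \<le> udim R" for p using udim_ge by blast
  moreover obtain d where "udim R = enat d" using fin by auto
  ultimately have "enat (Suc d) \<le> enat d" by metis
  then show False by simp
qed

section \<open>Counting independent vectors with uniform coordinates\<close>

lemma uniform_element_overlap:
  assumes u: "uniform_element R u"
    and "x \<in> {r \<otimes> u | r. r \<in> carrier R}" "x \<noteq> \<zero>" "y \<in> {r \<otimes> u | r. r \<in> carrier R}" "y \<noteq> \<zero>"
  shows "\<exists>s\<in>carrier R. \<exists>t\<in>carrier R. s \<otimes> x = t \<otimes> y \<and> s \<otimes> x \<noteq> \<zero>"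
  using assms unfolding uniform_element_def by blast

text \<open>Gaussian elimination: a vector that meets the kernel of the coordinate \<open>c\<close> trivially serves
  as pivot for clearing the coordinate \<open>c\<close> of suitable multiples of the others.\<close>

lemma card_le_uniform_coordinates:
  assumes "finite C" "finite I"
    and "\<And>c. c \<in> C \<Longrightarrow> left_ideal (U c) R"
    and "\<And>c x y. c \<in> C \<Longrightarrow> x \<in> U c \<Longrightarrow> x \<noteq> \<zero> \<Longrightarrow> y \<in> U c \<Longrightarrow> y \<noteq> \<zero> \<Longrightarrow>
      \<exists>s\<in>carrier R. \<exists>t\<in>carrier R. s \<otimes> x = t \<otimes> y \<and> s \<otimes> x \<noteq> \<zero>"
    and "\<And>i c. i \<in> I \<Longrightarrow> c \<in> C \<Longrightarrow> v i c \<in> U c"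
    and "\<And>i. i \<in> I \<Longrightarrow> \<exists>c\<in>C. v i c \<noteq> \<zero>"
    and "\<And>r. r \<in> I \<rightarrow> carrier R \<Longrightarrow> (\<And>c. c \<in> C \<Longrightarrow> (\<Oplus>i\<in>I. r i \<otimes> v i c) = \<zero>) \<Longrightarrow>
      \<forall>i\<in>I. \<forall>c\<in>C. r i \<otimes> v i c = \<zero>"
  shows "card I \<le> card C"
  using assms
proof (induction C arbitrary: I v rule: finite_induct)
  case empty
  then show ?case by (cases "I = {}") auto
next
  case (insert c C)
  note fin = insert.prems(1) and U = insert.prems(2) and overlap = insert.prems(3)
    and vU = insert.prems(4) and nz = insert.prems(5) and ind = insert.prems(6)
  have Uc: "x \<in> carrier R" if "d \<in> insert c C" "x \<in> U d" for d x
    using left_ideal_closed(1)[OF U] that by blast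
  have vc: "v i d \<in> carrier R" if "i \<in> I" "d \<in> insert c C" for i d
    using Uc vU that by blast
  \<comment> \<open>Some multiple of vector \<open>i\<close> loses coordinate \<open>c\<close> but
    not all others. If every vector has such a multiple, these multiples need only the coordinates
    in \<open>C\<close>; a vector without one is the pivot.\<close>
  define meets where
    "meets i \<longleftrightarrow> (\<exists>s\<in>carrier R. s \<otimes> v i c = \<zero> \<and> (\<exists>d\<in>C. s \<otimes> v i d \<noteq> \<zero>))" for i
  show ?case
  proof (cases "\<forall>i\<in>I. meets i")
    case True
    then have "\<exists>s. \<forall>i\<in>I. s i \<in> carrier R \<and> s i \<otimes> v i c = \<zero> \<and> (\<exists>d\<in>C. s i \<otimes> v i d \<noteq> \<zero>)"
      unfolding meets_def by (intro bchoice) blast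
    then obtain s where s: "\<And>i. i \<in> I \<Longrightarrow> s i \<in> carrier R" "\<And>i. i \<in> I \<Longrightarrow> s i \<otimes> v i c = \<zero>"
      "\<And>i. i \<in> I \<Longrightarrow> \<exists>d\<in>C. s i \<otimes> v i d \<noteq> \<zero>" by blast
    have "card I \<le> card C"
    proof (rule insert.IH[of I "\<lambda>i d. s i \<otimes> v i d"])
      show "left_ideal (U d) R" if "d \<in> C" for d using U that by simp
      show "s i \<otimes> v i d \<in> U d" if "i \<in> I" "d \<in> C" for i d
        using left_ideal_closed(4)[OF U] s vU that by blast
      show "\<forall>i\<in>I. \<forall>d\<in>C. r i \<otimes> (s i \<otimes> v i d) = \<zero>"
        if r: "r \<in> I \<rightarrow> carrier R" and sum: "\<And>d. d \<in> C \<Longrightarrow> (\<Oplus>i\<in>I. r i \<otimes> (s i \<otimes> v i d)) = \<zero>" for r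
      proof -
        have assoc: "r i \<otimes> (s i \<otimes> v i d) = (r i \<otimes> s i) \<otimes> v i d" if "i \<in> I" "d \<in> insert c C" for i d
          using r s vc that by (simp add: m_assoc Pi_def)
        have "(\<Oplus>i\<in>I. (r i \<otimes> s i) \<otimes> v i d) = \<zero>" if d: "d \<in> insert c C" for d
        proof -
          have "(\<Oplus>i\<in>I. (r i \<otimes> s i) \<otimes> v i d) = (\<Oplus>i\<in>I. r i \<otimes> (s i \<otimes> v i d))"
            using r s vc d assoc by (intro finsum_cong') (auto simp: Pi_def)
          also have "\<dots> = \<zero>"
          proof (cases "d = c")
            case True
            then show ?thesis using s r by (intro add.finprod_one_eqI) (auto simp: Pi_def)
          qed (use sum d in auto)
          finally show ?thesis .
        qed
        then have "\<forall>i\<in>I. \<forall>d\<in>insert c C. (r i \<otimes> s i) \<otimes> v i d = \<zero>"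
          using r s by (intro ind) auto
        then show ?thesis using assoc by simp
      qed
      show "\<exists>sa\<in>carrier R. \<exists>t\<in>carrier R. sa \<otimes> x = t \<otimes> y \<and> sa \<otimes> x \<noteq> \<zero>"
        if "d \<in> C" "x \<in> U d" "x \<noteq> \<zero>" "y \<in> U d" "y \<noteq> \<zero>" for d x y
        using overlap[of d x y] that by blast
    qed (use fin s in auto)
    then show ?thesis using insert.hyps by simp
  next
    case False
    then obtain j where j: "j \<in> I" "\<not> meets j" by blast
    have jz: "t \<otimes> v j d = \<zero>" if "t \<in> carrier R" "t \<otimes> v j c = \<zero>" "d \<in> insert c C" for t d
      using j that unfolding meets_def by blast
    have nonzero: "v i c \<noteq> \<zero>" if i: "i \<in> I" "\<not> meets i" for i
    proof
      assume "v i c = \<zero>"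
      moreover have "\<forall>d\<in>C. \<one> \<otimes> v i d = \<zero>"
        using i(2) calculation unfolding meets_def by (metis one_closed r_null)
      ultimately show False using nz[OF i(1)] vc[OF i(1)] by auto
    qed
    \<comment> \<open>If \<open>meets i\<close>, coordinate \<open>c\<close> is already cleared by a
      multiple and \<open>t = \<zero>\<close> works; otherwise it is nonzero and the overlap
      property provides a common multiple with the pivot.\<close>
    have "\<exists>s. \<exists>t. s \<in> carrier R \<and> t \<in> carrier R \<and> s \<otimes> v i c = t \<otimes> v j c \<and>
        (\<exists>d\<in>insert c C. s \<otimes> v i d \<noteq> \<zero>)" if i: "i \<in> I" for i
    proof (cases "meets i")
      case True
      then obtain s where "s \<in> carrier R" "s \<otimes> v i c = \<zero>" "\<exists>d\<in>C. s \<otimes> v i d \<noteq> \<zero>"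
        by (auto simp: meets_def)
      moreover have "\<zero> \<otimes> v j c = \<zero>" using vc j by simp
      ultimately show ?thesis by (metis insertCI zero_closed)
    next
      case False
      then show ?thesis
        using overlap[of c "v i c" "v j c"] vU i j nonzero[OF i False] nonzero[OF j] by blast
    qed
    then obtain s t where st: "\<And>i. i \<in> I \<Longrightarrow> s i \<in> carrier R" "\<And>i. i \<in> I \<Longrightarrow> t i \<in> carrier R"
      "\<And>i. i \<in> I \<Longrightarrow> s i \<otimes> v i c = t i \<otimes> v j c" "\<And>i. i \<in> I \<Longrightarrow> \<exists>d\<in>insert c C. s i \<otimes> v i d \<noteq> \<zero>"
      by metis
    define w where "w i d = s i \<otimes> v i d \<ominus> t i \<otimes> v j d" for i d
    have wc: "w i d \<in> carrier R" if "i \<in> I" "d \<in> insert c C" for i d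
      using st vc j that by (simp add: w_def)
    have key: "r i \<otimes> s i \<otimes> v i d = \<zero>"
      if r: "r \<in> I - {j} \<rightarrow> carrier R" and sum: "\<And>d. d \<in> C \<Longrightarrow> (\<Oplus>i\<in>I - {j}. r i \<otimes> w i d) = \<zero>"
        and i: "i \<in> I - {j}" and d: "d \<in> insert c C" for r i d
    proof -
      have rc: "r i \<in> carrier R" if "i \<in> I" "i \<noteq> j" for i using r that by auto
      define b where "b = (\<Oplus>i\<in>I - {j}. r i \<otimes> t i)"
      have b: "b \<in> carrier R" unfolding b_def using rc st by (intro finsum_closed) auto
      \<comment> \<open>A relation between the \<open>w i\<close> becomes one between the original
        vectors, the subtracted multiples of the pivot being collected in
        \<open>\<ominus> b\<close>.\<close>
      define r' where "r' i = (if i = j then \<ominus> b else r i \<otimes> s i)" for i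
      have r'c: "r' \<in> I \<rightarrow> carrier R" using b rc st by (auto simp: r'_def)
      have "(\<Oplus>i\<in>I. r' i \<otimes> v i e) = \<zero>" if e: "e \<in> insert c C" for e
      proof -
        have 1: "(\<Oplus>i\<in>I - {j}. r i \<otimes> w i e) = \<zero>"
        proof (cases "e = c")
          case True
          have "w i c = \<zero>" if "i \<in> I" for i
            using st vc j that by (simp add: w_def a_minus_def r_neg)
          then show ?thesis
            using True rc by (intro add.finprod_one_eqI) auto
        qed (use sum e in auto)
        have bv: "b \<otimes> v j e = (\<Oplus>i\<in>I - {j}. r i \<otimes> t i \<otimes> v j e)"
          unfolding b_def using fin vc[OF j(1) e] rc st by (intro finsum_ldistr) auto
        have "(\<Oplus>i\<in>I - {j}. r i \<otimes> s i \<otimes> v i e) = (\<Oplus>i\<in>I - {j}. r i \<otimes> w i e \<oplus> r i \<otimes> t i \<otimes> v j e)"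
        proof (rule finsum_cong')
          fix i assume i: "i \<in> I - {j}"
          have "s i \<otimes> v i e = w i e \<oplus> t i \<otimes> v j e"
            using i e st vc j by (simp add: w_def a_minus_def a_assoc l_neg)
          then have "r i \<otimes> (s i \<otimes> v i e) = r i \<otimes> w i e \<oplus> r i \<otimes> (t i \<otimes> v j e)"
            using i e st vc j rc wc by (simp add: r_distr)
          then show "r i \<otimes> s i \<otimes> v i e = r i \<otimes> w i e \<oplus> r i \<otimes> t i \<otimes> v j e"
            using i e st vc j rc by (simp add: m_assoc)
        qed (use e st vc j rc wc in auto)
        also have "\<dots> = (\<Oplus>i\<in>I - {j}. r i \<otimes> w i e) \<oplus> (\<Oplus>i\<in>I - {j}. r i \<otimes> t i \<otimes> v j e)"
          using e st vc j rc wc by (intro finsum_addf) auto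
        also have "\<dots> = b \<otimes> v j e"
          unfolding 1 bv[symmetric] using b vc[OF j(1) e] by simp
        finally have 2: "(\<Oplus>i\<in>I - {j}. r i \<otimes> s i \<otimes> v i e) = b \<otimes> v j e" .
        have "(\<Oplus>i\<in>I. r' i \<otimes> v i e) = (\<Oplus>i\<in>insert j (I - {j}). r' i \<otimes> v i e)"
          using j by (simp add: insert_absorb)
        also have "\<dots> = r' j \<otimes> v j e \<oplus> (\<Oplus>i\<in>I - {j}. r' i \<otimes> v i e)"
          using fin j e vc r'c by (intro finsum_insert) (auto simp: Pi_def)
        also have "(\<Oplus>i\<in>I - {j}. r' i \<otimes> v i e) = (\<Oplus>i\<in>I - {j}. r i \<otimes> s i \<otimes> v i e)"
          using e vc st rc by (intro finsum_cong') (auto simp: r'_def)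
        finally show ?thesis using 2 b vc[OF j(1) e] by (simp add: r'_def l_minus l_neg)
      qed
      then have "\<forall>i\<in>I. \<forall>e\<in>insert c C. r' i \<otimes> v i e = \<zero>" by (intro ind r'c)
      then show ?thesis using i d by (auto simp: r'_def)
    qed
    have "card (I - {j}) \<le> card C"
    proof (rule insert.IH[of "I - {j}" w])
      show "left_ideal (U d) R" if "d \<in> C" for d using U that by simp
      show "w i d \<in> U d" if "i \<in> I - {j}" "d \<in> C" for i d
      proof -
        have i: "i \<in> I" and d: "d \<in> insert c C" using that by auto
        show ?thesis
          unfolding w_def
          by (intro left_ideal_closed(3,4)[OF U[OF d]] st(1,2) vU i d j(1))
      qed
      \<comment> \<open>If \<open>w i\<close> vanished on \<open>C\<close>, the coefficient
        \<open>\<one>\<close> at \<open>i\<close> alone would form a relation, and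
        \<open>key\<close> would kill \<open>s i \<otimes> v i d\<close> for all \<open>d\<close>,
        against the choice of \<open>s i\<close>.\<close>
      show "\<exists>d\<in>C. w i d \<noteq> \<zero>" if i: "i \<in> I - {j}" for i
      proof (rule ccontr)
        assume "\<not> ?thesis"
        then have "(\<Oplus>k\<in>I - {j}. (if k = i then \<one> else \<zero>) \<otimes> w k d) = \<zero>" if "d \<in> C" for d
          using that wc by (intro add.finprod_one_eqI) auto
        then have "(if i = i then \<one> else \<zero>) \<otimes> s i \<otimes> v i d = \<zero>" if "d \<in> insert c C" for d
          using i that by (intro key[of "\<lambda>k. if k = i then \<one> else \<zero>"]) auto
        then have "s i \<otimes> v i d = \<zero>" if "d \<in> insert c C" for d
          using st(1)[of i] i vc that by simp
        then show False using st(4)[of i] i by blast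
      qed
      show "\<forall>i\<in>I - {j}. \<forall>d\<in>C. r i \<otimes> w i d = \<zero>"
        if r: "r \<in> I - {j} \<rightarrow> carrier R" and sum: "\<And>d. d \<in> C \<Longrightarrow> (\<Oplus>i\<in>I - {j}. r i \<otimes> w i d) = \<zero>" for r
      proof (intro ballI)
        fix i d assume i: "i \<in> I - {j}" and d: "d \<in> C"
        have ri: "r i \<in> carrier R" using r i by auto
        have sv: "r i \<otimes> (s i \<otimes> v i e) = \<zero>" if "e \<in> insert c C" for e
          using key[OF r sum i that] ri st vc that i by (simp add: m_assoc)
        \<comment> \<open>The pivot multiple vanishes in coordinate \<open>c\<close>, hence in all
          coordinates by \<open>jz\<close>.\<close>
        have "r i \<otimes> t i \<otimes> v j c = \<zero>"
        proof -
          have "r i \<otimes> t i \<otimes> v j c = r i \<otimes> (t i \<otimes> v j c)"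
            using st(2) i ri vc[OF j(1)] by (simp add: m_assoc)
          also have "\<dots> = r i \<otimes> (s i \<otimes> v i c)" using st(3) i by simp
          finally show ?thesis using sv by simp
        qed
        moreover have "r i \<otimes> t i \<in> carrier R" using ri st(2) i by simp
        ultimately have "r i \<otimes> t i \<otimes> v j d = \<zero>" using jz d by blast
        then have "r i \<otimes> (t i \<otimes> v j d) = \<zero>" using ri st(2) vc i j(1) d by (simp add: m_assoc)
        then show "r i \<otimes> w i d = \<zero>"
          using sv[of d] d i ri st(1,2) vc j(1)
          by (simp add: w_def a_minus_def r_distr r_minus)
      qed
      show "\<exists>s\<in>carrier R. \<exists>t\<in>carrier R. s \<otimes> x = t \<otimes> y \<and> s \<otimes> x \<noteq> \<zero>"
        if "d \<in> C" "x \<in> U d" "x \<noteq> \<zero>" "y \<in> U d" "y \<noteq> \<zero>" for d x y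
        using overlap[of d x y] that by blast
    qed (use fin in auto)
    then show ?thesis using insert.hyps fin j by (simp add: card_Diff_singleton)
  qed
qed

text \<open>Coordinate \<open>(d, l)\<close> of a vector is \<open>v i d \<otimes> u l\<close>, and
  \<open>faithful\<close> ensures that nothing is lost. The index set \<open>I\<close> is arbitrary
  because later vectors are indexed by pairs of an exponent of \<open>x\<close> and the number of an
  element.\<close>

lemma complete_system_bound:
  assumes cs: "complete_system R n u" and fin: "finite I"
    and v: "\<And>i d. i \<in> I \<Longrightarrow> d < K \<Longrightarrow> v i d \<in> carrier R"
    and nz: "\<And>i. i \<in> I \<Longrightarrow> \<exists>d<K. v i d \<noteq> \<zero>"
    and ind: "\<And>r. r \<in> I \<rightarrow> carrier R \<Longrightarrow> (\<And>d. d < K \<Longrightarrow> (\<Oplus>i\<in>I. r i \<otimes> v i d) = \<zero>) \<Longrightarrow>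
      \<forall>i\<in>I. \<forall>d<K. r i \<otimes> v i d = \<zero>"
  shows "card I \<le> K * n"
proof -
  have unif: "uniform_element R (u l)" if "l < n" for l
    using cs that by (auto simp: complete_system_def good_system_def good_element_def)
  then have uc: "u l \<in> carrier R" if "l < n" for l
    using that by (auto simp: uniform_element_def)
  have faithful: "r = \<zero>" if "r \<in> carrier R" "\<And>l. l < n \<Longrightarrow> r \<otimes> u l = \<zero>" for r
    using cs that by (auto simp: complete_system_def)
  have "card I \<le> card ({..<K} \<times> {..<n})"
  proof (rule card_le_uniform_coordinates
      [where U = "\<lambda>c. {r \<otimes> u (snd c) | r. r \<in> carrier R}" and v = "\<lambda>i c. v i (fst c) \<otimes> u (snd c)"])
    show "left_ideal {r \<otimes> u (snd c) |r. r \<in> carrier R} R" if "c \<in> {..<K} \<times> {..<n}" for c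
      using that uc by (intro left_ideal_principal) auto
    show "\<exists>s\<in>carrier R. \<exists>t\<in>carrier R. s \<otimes> x = t \<otimes> y \<and> s \<otimes> x \<noteq> \<zero>"
      if "c \<in> {..<K} \<times> {..<n}" "x \<in> {r \<otimes> u (snd c) |r. r \<in> carrier R}" "x \<noteq> \<zero>"
        "y \<in> {r \<otimes> u (snd c) |r. r \<in> carrier R}" "y \<noteq> \<zero>" for c x y
      using that unif by (intro uniform_element_overlap[of "u (snd c)"]) auto
    show "v i (fst c) \<otimes> u (snd c) \<in> {r \<otimes> u (snd c) |r. r \<in> carrier R}"
      if "i \<in> I" "c \<in> {..<K} \<times> {..<n}" for i c
      using v that by auto
    show "\<exists>c\<in>{..<K} \<times> {..<n}. v i (fst c) \<otimes> u (snd c) \<noteq> \<zero>" if i: "i \<in> I" for i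
    proof -
      obtain d where d: "d < K" "v i d \<noteq> \<zero>" using nz[OF i] by blast
      then obtain l where "l < n" "v i d \<otimes> u l \<noteq> \<zero>" using faithful[of "v i d"] v i by blast
      then show ?thesis using d by (intro bexI[of _ "(d, l)"]) auto
    qed
    show "\<forall>i\<in>I. \<forall>c\<in>{..<K} \<times> {..<n}. r i \<otimes> (v i (fst c) \<otimes> u (snd c)) = \<zero>"
      if r: "r \<in> I \<rightarrow> carrier R"
        and sum: "\<And>c. c \<in> {..<K} \<times> {..<n} \<Longrightarrow> (\<Oplus>i\<in>I. r i \<otimes> (v i (fst c) \<otimes> u (snd c))) = \<zero>" for r
    proof -
      have "(\<Oplus>i\<in>I. r i \<otimes> v i d) = \<zero>" if d: "d < K" for d
      proof (rule faithful)
        show "(\<Oplus>i\<in>I. r i \<otimes> v i d) \<in> carrier R" using r v d by (intro finsum_closed) auto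
        fix l assume l: "l < n"
        have "(\<Oplus>i\<in>I. r i \<otimes> v i d) \<otimes> u l = (\<Oplus>i\<in>I. r i \<otimes> v i d \<otimes> u l)"
          using fin uc l r v d by (intro finsum_ldistr) auto
        also have "\<dots> = (\<Oplus>i\<in>I. r i \<otimes> (v i d \<otimes> u l))"
          using uc l r v d by (intro finsum_cong') (auto simp: m_assoc Pi_def)
        also have "\<dots> = \<zero>" using sum[of "(d, l)"] d l by simp
        finally show "(\<Oplus>i\<in>I. r i \<otimes> v i d) \<otimes> u l = \<zero>" .
      qed
      then have "\<forall>i\<in>I. \<forall>d<K. r i \<otimes> v i d = \<zero>" by (intro ind r)
      then show ?thesis
        using r v uc by (auto simp: m_assoc[symmetric] Pi_def)
    qed
  qed (use fin in auto)
  then show ?thesis by (simp add: card_cartesian_product)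
qed

lemma complete_system_independent_le:
  assumes "complete_system R n u" "independent_elements R p v"
  shows "p \<le> n"
proof -
  have "card {..<p} \<le> 1 * n"
  proof (rule complete_system_bound[OF assms(1), where v = "\<lambda>i _. v i"])
    show "\<forall>i\<in>{..<p}. \<forall>d<1. r i \<otimes> v i = \<zero>"
      if "r \<in> {..<p} \<rightarrow> carrier R" "\<And>d. d < (1::nat) \<Longrightarrow> (\<Oplus>i\<in>{..<p}. r i \<otimes> v i) = \<zero>" for r
      using assms(2) that unfolding independent_elements_def by (auto simp: Pi_def)
  qed (use assms(2) in \<open>auto simp: independent_elements_def\<close>)
  then show ?thesis by simp
qed

section \<open>Good elements and the dimension given by a complete system\<close>

lemma good_element_nonzero:
  assumes "good_element R u"
  shows "u \<in> carrier R" "u \<noteq> \<zero>" "u \<otimes> u \<otimes> u \<noteq> \<zero>"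
proof -
  show u: "u \<in> carrier R" "u \<noteq> \<zero>" using assms by (auto simp: good_element_def uniform_element_def)
  have cancel: "r \<otimes> u = \<zero>" if "r \<in> carrier R" "r \<otimes> u \<otimes> u = \<zero>" for r
    using assms that by (auto simp: good_element_def)
  show "u \<otimes> u \<otimes> u \<noteq> \<zero>" using cancel[of u] cancel[of \<one>] u by auto
qed

lemma good_system_independent:
  assumes "good_system R n u" shows "independent_elements R n u"
  using assms
  by (intro triangular_independent)
     (auto simp: good_system_def good_element_nonzero, auto simp: good_element_def)

lemma udim_complete_system:
  assumes "complete_system R n u" shows "udim R = enat n"
proof (rule antisym)
  show "udim R \<le> enat n"
    using complete_system_independent_le[OF assms] by (intro udim_le)
  show "enat n \<le> udim R"
    using assms good_system_independent by (intro udim_ge) (auto simp: complete_system_def)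
qed

end

section \<open>Existence of complete systems in semiprime left Goldie rings\<close>

locale semiprime_left_goldie = ring R for R (structure) +
  assumes semiprime: "semiprime_ring R" and goldie: "left_goldie R"
begin

lemma nonsingular: "left_singular R z \<Longrightarrow> z = \<zero>"
  using semiprime_acc_nonsingular semiprime goldie by (auto simp: left_goldie_def)

text \<open>By nonsingularity the left annihilator of a nonzero \<open>y\<close> is not essential.
  The multiplier \<open>h y\<close> substitutes for regularity of \<open>y\<close>: on
  \<open>R (h y)\<close>, right multiplication by \<open>y\<close> is injective.\<close>

lemma annihilator_complements:
  obtains h where "\<And>y. y \<in> carrier R \<Longrightarrow> y \<noteq> \<zero> \<Longrightarrow> h y \<in> carrier R"
    and "\<And>y. y \<in> carrier R \<Longrightarrow> y \<noteq> \<zero> \<Longrightarrow> h y \<noteq> \<zero>"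
    and "\<And>y r. y \<in> carrier R \<Longrightarrow> y \<noteq> \<zero> \<Longrightarrow> r \<in> carrier R \<Longrightarrow> r \<otimes> h y \<otimes> y = \<zero> \<Longrightarrow> r \<otimes> h y = \<zero>"
proof -
  have "\<exists>s. s \<in> carrier R \<and> s \<noteq> \<zero> \<and> (\<forall>r\<in>carrier R. r \<otimes> s \<otimes> y = \<zero> \<longrightarrow> r \<otimes> s = \<zero>)"
    if "y \<in> carrier R - {\<zero>}" for y
    using that nonsingular[of y] unfolding left_singular_def by blast
  then have "\<forall>y\<in>carrier R - {\<zero>}. \<exists>s. s \<in> carrier R \<and> s \<noteq> \<zero> \<and>
      (\<forall>r\<in>carrier R. r \<otimes> s \<otimes> y = \<zero> \<longrightarrow> r \<otimes> s = \<zero>)" by simp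
  from bchoice[OF this] show thesis using that by blast
qed

text \<open>Let \<open>w\<close> be a uniform multiple of \<open>x\<close> and
  \<open>w \<otimes> r \<otimes> w\<close> nonzero; then \<open>y = r \<otimes> w\<close> is good.
  For if \<open>s \<otimes> y \<otimes> y = \<zero>\<close> but \<open>s \<otimes> y\<close> is
  nonzero, uniformity gives every nonzero \<open>a \<otimes> w\<close> a nonzero multiple in
  \<open>R (s \<otimes> y)\<close>, which \<open>y\<close> kills from the right; this makes the
  nonzero \<open>w \<otimes> y\<close> singular.\<close>

lemma good_element_exists:
  assumes x: "x \<in> carrier R" "x \<noteq> \<zero>"
  shows "\<exists>t\<in>carrier R. good_element R (t \<otimes> x)"
proof -
  obtain t where t: "t \<in> carrier R" and w: "uniform_element R (t \<otimes> x)"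
    using uniform_element_exists x goldie by (auto simp: left_goldie_def)
  define w where "w = t \<otimes> x"
  have wc: "w \<in> carrier R" "w \<noteq> \<zero>" and wu: "uniform_element R w"
    using w by (auto simp: w_def uniform_element_def)
  obtain r where r: "r \<in> carrier R" "w \<otimes> r \<otimes> w \<noteq> \<zero>"
    using semiprime_element[OF semiprime] wc by blast
  define y where "y = r \<otimes> w"
  have yc: "y \<in> carrier R" "w \<otimes> y \<noteq> \<zero>" using r wc by (auto simp: y_def m_assoc)
  then have "y \<noteq> \<zero>" using wc by auto
  then have yu: "uniform_element R y" unfolding y_def using wu r by (intro uniform_element_mult) auto
  have "s \<otimes> y = \<zero>" if s: "s \<in> carrier R" "s \<otimes> y \<otimes> y = \<zero>" for s
  proof (rule ccontr)
    assume sy: "s \<otimes> y \<noteq> \<zero>"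
    have "left_singular R (w \<otimes> y)"
      unfolding left_singular_def
    proof (intro conjI ballI impI)
      fix a assume a: "a \<in> carrier R" "a \<noteq> \<zero>"
      show "\<exists>q\<in>carrier R. q \<otimes> a \<noteq> \<zero> \<and> q \<otimes> a \<otimes> (w \<otimes> y) = \<zero>"
      proof (cases "a \<otimes> w = \<zero>")
        case True
        then have "a \<otimes> (w \<otimes> y) = \<zero>" using a wc yc by (simp add: m_assoc[symmetric])
        then show ?thesis using a by (intro bexI[of _ \<one>]) auto
      next
        case False
        have "s \<otimes> r \<otimes> w \<noteq> \<zero>" using sy s r wc by (simp add: y_def m_assoc)
        then obtain b c where bc: "b \<in> carrier R" "c \<in> carrier R"
          "b \<otimes> (a \<otimes> w) = c \<otimes> (s \<otimes> r \<otimes> w)" "b \<otimes> (a \<otimes> w) \<noteq> \<zero>"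
          using wu[unfolded uniform_element_def] False a(1) m_closed[OF s(1) r(1)] by blast
        have "b \<otimes> a \<noteq> \<zero>" using bc a wc by (auto simp: m_assoc[symmetric])
        moreover have "b \<otimes> a \<otimes> (w \<otimes> y) = c \<otimes> (s \<otimes> y \<otimes> y)"
        proof -
          have "b \<otimes> a \<otimes> (w \<otimes> y) = b \<otimes> (a \<otimes> w) \<otimes> y" using bc(1) a wc yc by (simp add: m_assoc)
          also have "\<dots> = c \<otimes> (s \<otimes> r \<otimes> w) \<otimes> y" by (simp only: bc(3))
          also have "\<dots> = c \<otimes> (s \<otimes> y \<otimes> y)" using bc s r wc yc(1) by (simp add: y_def m_assoc)
          finally show ?thesis .
        qed
        ultimately show ?thesis using bc s(2) by (intro bexI[of _ b]) auto
      qed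
    qed (use wc yc in auto)
    then show False using nonsingular yc by blast
  qed
  then have "good_element R y" using yu by (auto simp: good_element_def)
  moreover have "y = (r \<otimes> t) \<otimes> x" using r t x by (simp add: y_def w_def m_assoc)
  ultimately show ?thesis using r t by (intro bexI[of _ "r \<otimes> t"]) auto
qed

text \<open>A good extension of greatest length exists since \<open>udim R\<close> bounds the
  length. It is complete: a nonzero \<open>x\<close> killing all members would have a good multiple
  that could be appended. The prescribed beginning allows a given good element to become member
  0.\<close>

lemma complete_system_extends:
  assumes "good_system R k w"
  shows "\<exists>n u. complete_system R n u \<and> k \<le> n \<and> (\<forall>i<k. u i = w i)"
proof -
  define P where "P n \<longleftrightarrow> (\<exists>u. good_system R n u \<and> k \<le> n \<and> (\<forall>i<k. u i = w i))" for n
  obtain d where d: "udim R = enat d" using goldie by (auto simp: left_goldie_def)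
  have "n \<le> d" if "P n" for n
    using that udim_ge good_system_independent d unfolding P_def by (metis enat_ord_simps(1))
  moreover have "P k" using assms by (auto simp: P_def)
  ultimately obtain n where n: "P n" "\<And>m. P m \<Longrightarrow> m \<le> n"
    using GreatestI_nat[of P k d] Greatest_le_nat[of P _ d] by metis
  then obtain u where u: "good_system R n u" "k \<le> n" "\<forall>i<k. u i = w i" by (auto simp: P_def)
  have uc: "u i \<in> carrier R" if "i < n" for i
    using u that by (auto simp: good_system_def good_element_nonzero)
  have "complete_system R n u"
    unfolding complete_system_def
  proof (intro conjI ballI impI u)
    fix x assume x: "x \<in> carrier R" "\<forall>i<n. x \<otimes> u i = \<zero>"
    show "x = \<zero>"
    proof (rule ccontr)
      assume "x \<noteq> \<zero>"
      then obtain t where t: "t \<in> carrier R" "good_element R (t \<otimes> x)"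
        using good_element_exists x by blast
      have "t \<otimes> x \<otimes> u i = \<zero>" if "i < n" for i using t x uc that by (simp add: m_assoc)
      then have "good_system R (Suc n) (u(n := t \<otimes> x))"
        using u t by (auto simp: good_system_def less_Suc_eq)
      then have "P (Suc n)" using u by (auto simp: P_def intro!: exI[of _ "u(n := t \<otimes> x)"])
      then show False using n(2) by fastforce
    qed
  qed
  then show ?thesis using u by blast
qed

end

section \<open>Leading terms and truncated polynomials in the Ore extension\<close>

locale goldie_ore_data = ore_data R \<sigma> \<delta> + semiprime_left_goldie R
  for R (structure) and \<sigma> \<delta> +
  assumes inj: "inj_on \<sigma> (carrier R)"
begin

abbreviation "S \<equiv> ore_extension R \<sigma> \<delta>"

lemma ore_simps [simp]:
  "carrier S = up R" "p \<otimes>\<^bsub>S\<^esub> q = mlt p q" "p \<oplus>\<^bsub>S\<^esub> q = (\<lambda>n. p n \<oplus> q n)" "\<zero>\<^bsub>S\<^esub> = (\<lambda>n. \<zero>)"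
  by (simp_all add: ore_extension_def)

sublocale S: ring S by (rule ore_extension_ring)

lemma finsum_ore:
  assumes "finite F" "\<And>i. i \<in> F \<Longrightarrow> f i \<in> up R"
  shows "(\<Oplus>\<^bsub>S\<^esub>i\<in>F. f i) n = (\<Oplus>i\<in>F. f i n)"
  using assms
proof (induction F rule: finite_induct)
  case (insert k F)
  then show ?case by (subst S.finsum_insert, auto, subst finsum_insert, auto)
qed simp

lemma sgpow_closed [simp, intro]: "a \<in> carrier R \<Longrightarrow> (\<sigma> ^^ i) a \<in> carrier R"
  by (induction i) auto

lemma sgpow_nonzero: "a \<in> carrier R \<Longrightarrow> a \<noteq> \<zero> \<Longrightarrow> (\<sigma> ^^ i) a \<noteq> \<zero>"
proof (induction i)
  case (Suc i)
  then show ?case using inj_onD[OF inj, of "(\<sigma> ^^ i) a" \<zero>] by auto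
qed simp

lemma sgpow_mult:
  "a \<in> carrier R \<Longrightarrow> b \<in> carrier R \<Longrightarrow> (\<sigma> ^^ i) (a \<otimes> b) = (\<sigma> ^^ i) a \<otimes> (\<sigma> ^^ i) b"
  by (induction i) auto

text \<open>\<delta> does not raise degrees, so \<sigma> alone acts on the top coefficient.\<close>

lemma Xpow_degree:
  assumes g: "g \<in> up R" "\<And>m. e < m \<Longrightarrow> g m = \<zero>"
  shows "(xop ^^ i) g (i + e) = (\<sigma> ^^ i) (g e)" "i + e < m \<Longrightarrow> (xop ^^ i) g m = \<zero>"
proof -
  have "(xop ^^ i) g (i + e) = (\<sigma> ^^ i) (g e) \<and> (\<forall>m>i + e. (xop ^^ i) g m = \<zero>)"
  proof (induction i)
    case (Suc i)
    have "xop ((xop ^^ i) g) m = \<zero>" if "Suc i + e < m" for m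
      using that Suc.IH by (cases m) (simp_all add: ore_x_def[of R \<sigma> \<delta> "(xop ^^ i) g"])
    moreover have "xop ((xop ^^ i) g) (Suc (i + e)) = \<sigma> ((\<sigma> ^^ i) (g e))"
      using Suc.IH g(1) by (simp add: ore_x_def[of R \<sigma> \<delta> "(xop ^^ i) g"] mem_upD)
    ultimately show ?case by simp
  qed (use g in auto)
  then show "(xop ^^ i) g (i + e) = (\<sigma> ^^ i) (g e)" "i + e < m \<Longrightarrow> (xop ^^ i) g m = \<zero>" by auto
qed

text \<open>With \<open>d\<close> the degree of \<open>G\<close>, the coefficient of the product at
  \<open>d + e\<close> is the single term \<open>G d \<otimes> (\<sigma> ^^ d) (g e)\<close>. Since
  \<open>g e\<close> and its images may be zero divisors, \<open>reg\<close> speaks of the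
  coefficients of this \<open>G\<close> only.\<close>

lemma mult_eq_zero_cancel:
  assumes G: "G \<in> up R" and g: "g \<in> up R" "\<And>m. e < m \<Longrightarrow> g m = \<zero>"
    and reg: "\<And>j. G j \<otimes> (\<sigma> ^^ j) (g e) = \<zero> \<Longrightarrow> G j = \<zero>"
    and zero: "mlt G g = (\<lambda>n. \<zero>)"
  shows "G = (\<lambda>n. \<zero>)"
proof (rule ccontr)
  assume "G \<noteq> (\<lambda>n. \<zero>)"
  then obtain k where k: "G k \<noteq> \<zero>" by auto
  obtain N where N: "\<And>i. N < i \<Longrightarrow> G i = \<zero>" using up_common_bound[OF G G] by metis
  then have bd: "i \<le> N" if "G i \<noteq> \<zero>" for i using that by (meson not_le)
  define d where "d = (GREATEST i. G i \<noteq> \<zero>)"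
  have d: "G d \<noteq> \<zero>" "\<And>i. d < i \<Longrightarrow> G i = \<zero>"
    unfolding d_def using GreatestI_nat[of "\<lambda>i. G i \<noteq> \<zero>" k N] k bd
      Greatest_le_nat[of "\<lambda>i. G i \<noteq> \<zero>" _ N] by (auto simp: not_le[symmetric])
  have "mlt G g (d + e) = (\<Oplus>i\<in>{..d}. G i \<otimes> (xop ^^ i) g (d + e))"
    using mult_eq[OF G g(1) d(2)] .
  also have "\<dots> = G d \<otimes> (xop ^^ d) g (d + e)"
  proof (rule finsum_eq_single)
    fix i assume "i \<in> {..d}" "i \<noteq> d"
    then have "(xop ^^ i) g (d + e) = \<zero>" by (intro Xpow_degree(2)[OF g]) auto
    then show "G i \<otimes> (xop ^^ i) g (d + e) = \<zero>" using G by (simp add: mem_upD)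
  qed (use G g in \<open>auto simp: mem_upD\<close>)
  also have "\<dots> = G d \<otimes> (\<sigma> ^^ d) (g e)" using Xpow_degree(1)[OF g] by simp
  finally show False using zero reg d(1) by (simp add: fun_eq_iff)
qed

definition const :: "'a \<Rightarrow> nat \<Rightarrow> 'a" where "const a = (\<lambda>n. if n = 0 then a else \<zero>)"

lemma const_closed [simp, intro]: "a \<in> carrier R \<Longrightarrow> const a \<in> up R"
  by (auto simp: const_def up_def)

lemma const_mult: "a \<in> carrier R \<Longrightarrow> q \<in> up R \<Longrightarrow> mlt (const a) q = (\<lambda>n. a \<otimes> q n)"
  using mult_eq[of "const a" q 0] const_closed[of a] by (auto simp: const_def[of a] mem_upD)

lemma const_mult_const:
  "a \<in> carrier R \<Longrightarrow> b \<in> carrier R \<Longrightarrow> mlt (const a) (const b) = const (a \<otimes> b)"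
  by (auto simp: const_mult) (auto simp: const_def)

lemma const_eq_zero: "const a = (\<lambda>n. \<zero>) \<longleftrightarrow> a = \<zero>"
  by (auto simp: const_def fun_eq_iff)

lemma const_at_0: "const a 0 = a"
  by (simp add: const_def)

lemma const_pos: "0 < n \<Longrightarrow> const a n = \<zero>"
  by (simp add: const_def)

text \<open>The cut at \<open>K\<close> discards values of \<open>c\<close> built from coefficient
  functions that are unconstrained outside their index set.\<close>

definition truncated :: "nat \<Rightarrow> (nat \<Rightarrow> 'a) \<Rightarrow> nat \<Rightarrow> 'a" where
  "truncated K c = (\<lambda>j. if j < K then c j else \<zero>)"

lemma truncated_closed: "(\<And>j. j < K \<Longrightarrow> c j \<in> carrier R) \<Longrightarrow> truncated K c \<in> up R"
  by (auto simp: truncated_def up_def intro!: exI[of _ K])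

lemma truncated_mult:
  assumes "\<And>j. j < K \<Longrightarrow> c j \<in> carrier R" "q \<in> up R"
  shows "mlt (truncated K c) q n = (\<Oplus>j\<in>{..<K}. c j \<otimes> (xop ^^ j) q n)"
proof -
  have "mlt (truncated K c) q n = (\<Oplus>j\<in>{..K}. truncated K c j \<otimes> (xop ^^ j) q n)"
    using truncated_closed[of K c] assms by (intro mult_eq) (auto simp: truncated_def)
  also have "\<dots> = (\<Oplus>j\<in>{..<K}. c j \<otimes> (xop ^^ j) q n)"
    using assms by (intro add.finprod_mono_neutral_cong_right) (auto simp: truncated_def)
  finally show ?thesis .
qed

text \<open>Translates a linear relation over \<open>R\<close> between the \<open>x^j g i\<close>
  into a relation over \<open>S\<close> between the \<open>g i\<close>.\<close>

lemma finsum_truncated_mult: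
  fixes p :: nat
  assumes c: "\<And>j i. j < K \<Longrightarrow> i < p \<Longrightarrow> c (j, i) \<in> carrier R" and g: "\<And>i. i < p \<Longrightarrow> g i \<in> up R"
  shows "(\<Oplus>\<^bsub>S\<^esub>i\<in>{..<p}. mlt (truncated K (\<lambda>j. c (j, i))) (g i)) n =
    (\<Oplus>q\<in>{..<K} \<times> {..<p}. c q \<otimes> (xop ^^ fst q) (g (snd q)) n)"
proof -
  have "(\<Oplus>\<^bsub>S\<^esub>i\<in>{..<p}. mlt (truncated K (\<lambda>j. c (j, i))) (g i)) n =
      (\<Oplus>i\<in>{..<p}. mlt (truncated K (\<lambda>j. c (j, i))) (g i) n)"
    using c g by (intro finsum_ore) (auto intro!: mult_closed truncated_closed)
  also have "\<dots> = (\<Oplus>i\<in>{..<p}. \<Oplus>j\<in>{..<K}. c (j, i) \<otimes> (xop ^^ j) (g i) n)"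
    using c g by (intro finsum_cong') (auto simp: truncated_mult)
  also have "\<dots> = (\<Oplus>q\<in>{..<K} \<times> {..<p}. c q \<otimes> (xop ^^ fst q) (g (snd q)) n)"
    using c g by (subst finsum_Times) auto
  finally show ?thesis .
qed

section \<open>Cancellation of a good element in the Ore extension\<close>

text \<open>If \<open>f u\<close> were nonzero, then the \<open>x\<^sup>j u\<^sub>l\<close>, for \<open>j < K\<close> and a complete system
  \<open>u = u\<^sub>0, \<dots>, u\<^sub>n\<^sub>-\<^sub>1\<close>, together with \<open>f\<close> would, up to left multiples,
  provide \<open>K n + 1\<close> independent elements among the
  polynomials of degree less than \<open>K\<close>: multiplication by \<open>u\<^sup>2\<close> kills \<open>f\<close> and the \<open>x\<^sup>j u\<^sub>l\<close> with
  \<open>l > 0\<close>, and multiplication by \<open>u\<close> then separates \<open>f\<close> from the latter.\<close>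

lemma good_element_cancel_ore:
  assumes u: "good_element R u" and f: "f \<in> up R"
    and fuu: "mlt (mlt f (const u)) (const u) = (\<lambda>n. \<zero>)"
  shows "mlt f (const u) = (\<lambda>n. \<zero>)"
proof (rule ccontr)
  assume "mlt f (const u) \<noteq> (\<lambda>n. \<zero>)"
  then obtain m where m: "mlt f (const u) m \<noteq> \<zero>" by auto
  \<comment> \<open>As member 0 of the system, \<open>u\<close> is killed from the left by every
    later member.\<close>
  have "good_system R 1 (\<lambda>_. u)" using u by (simp add: good_system_def)
  then obtain n w where cs: "complete_system R n w" and n: "0 < n" and w0: "w 0 = u"
    using complete_system_extends by force
  have good: "good_element R (w l)" if "l < n" for l
    using cs that by (auto simp: complete_system_def good_system_def)
  note wc [simp] = good_element_nonzero(1)[OF good]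
  have tri: "w j \<otimes> w i = \<zero>" if "i < j" "j < n" for i j
    using cs that by (auto simp: complete_system_def good_system_def)
  obtain N where N: "\<And>i. N < i \<Longrightarrow> f i = \<zero>" using up_common_bound[OF f f] by metis
  \<comment> \<open>\<open>f\<close> and all \<open>x^j w l\<close> with \<open>j < K\<close> have
    degree less than this \<open>K\<close>.\<close>
  define K where "K = Suc N"
  \<comment> \<open>The cube counts one factor \<open>w 0\<close> present in the relation and two
    more from multiplying it twice by \<open>u\<close>; \<open>s\<close> below must allow all three
    to be cancelled.\<close>
  define y where "y j l = (\<sigma> ^^ j) (w l \<otimes> w l \<otimes> w l)" for j l
  have y: "y j l \<in> carrier R" "y j l \<noteq> \<zero>" if "l < n" for j l
    unfolding y_def using that good_element_nonzero[OF good] sgpow_nonzero by auto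
  obtain h where h: "\<And>y. y \<in> carrier R \<Longrightarrow> y \<noteq> \<zero> \<Longrightarrow> h y \<in> carrier R"
      "\<And>y. y \<in> carrier R \<Longrightarrow> y \<noteq> \<zero> \<Longrightarrow> h y \<noteq> \<zero>"
      "\<And>y r. y \<in> carrier R \<Longrightarrow> y \<noteq> \<zero> \<Longrightarrow> r \<in> carrier R \<Longrightarrow> r \<otimes> h y \<otimes> y = \<zero> \<Longrightarrow> r \<otimes> h y = \<zero>"
    using annihilator_complements by blast
  define s where "s j l = h (y j l)" for j l
  have s: "\<And>j l. l < n \<Longrightarrow> s j l \<in> carrier R" "\<And>j l. l < n \<Longrightarrow> s j l \<noteq> \<zero>"
    "\<And>j l r. l < n \<Longrightarrow> r \<in> carrier R \<Longrightarrow> r \<otimes> s j l \<otimes> y j l = \<zero> \<Longrightarrow> r \<otimes> s j l = \<zero>"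
    unfolding s_def by (intro h y; assumption)+
  have fu: "mlt f (const u) \<in> up R" using f u by (auto simp: good_element_nonzero)
  \<comment> \<open>A multiple of \<open>t\<close> that kills the nonzero coefficient
    \<open>m\<close> of \<open>f u\<close> is zero; this later turns \<open>b f u = 0\<close> into
    \<open>b = \<zero>\<close>.\<close>
  define t where "t = h (mlt f (const u) m)"
  have t: "t \<in> carrier R" "t \<noteq> \<zero>"
    "\<And>r. r \<in> carrier R \<Longrightarrow> r \<otimes> t \<otimes> mlt f (const u) m = \<zero> \<Longrightarrow> r \<otimes> t = \<zero>"
    unfolding t_def by (intro h m mem_upD[OF fu]; assumption)+
  \<comment> \<open>\<open>(0, n)\<close> is a spare index for \<open>t f\<close>, as the other
    pairs have second component below \<open>n\<close>; so \<open>I\<close> has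
    \<open>K * n + 1\<close> elements.\<close>
  define v where "v q d = (if q = (0, n) then t \<otimes> f d
    else s (fst q) (snd q) \<otimes> (xop ^^ fst q) (const (w (snd q))) d)" for q d
  define I where "I = insert (0, n) ({..<K} \<times> {..<n})"
  have deg: "(xop ^^ j) (const (w l)) j = (\<sigma> ^^ j) (w l)" if "l < n" for j l
    using Xpow_degree(1)[of "const (w l)" 0 j] that by (simp add: const_at_0 const_pos)
  have deg': "(xop ^^ j) (const (w l)) d = \<zero>" if "l < n" "j < d" for j l d
    using Xpow_degree(2)[of "const (w l)" 0 j d] that by (simp add: const_pos)
  have s_nonzero: "s j l \<otimes> (\<sigma> ^^ j) (w l) \<noteq> \<zero>" if l: "l < n" for j l
  proof
    assume 0: "s j l \<otimes> (\<sigma> ^^ j) (w l) = \<zero>"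
    have "\<one> \<otimes> s j l \<otimes> y j l = s j l \<otimes> (\<sigma> ^^ j) (w l) \<otimes> (\<sigma> ^^ j) (w l) \<otimes> (\<sigma> ^^ j) (w l)"
      using s l by (simp add: y_def sgpow_mult m_assoc)
    then have "\<one> \<otimes> s j l = \<zero>" using s l 0 by (intro s(3)) auto
    then show False using s l by simp
  qed
  have tf_nonzero: "r \<otimes> t = \<zero>" if r: "r \<in> carrier R" and z: "\<And>d. r \<otimes> t \<otimes> f d = \<zero>" for r
  proof -
    have "(\<lambda>d. r \<otimes> t \<otimes> mlt f (const u) d) = mlt (\<lambda>d. r \<otimes> t \<otimes> f d) (const u)"
      using r t f u by (intro mult_smult_left[symmetric]) (auto simp: good_element_nonzero)
    also have "\<dots> = (\<lambda>n. \<zero>)" by (simp add: z mult_zero_left)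
    finally show ?thesis using r by (intro t(3)) (auto simp: fun_eq_iff)
  qed
  have "card I \<le> K * n"
  proof (rule complete_system_bound[OF cs])
    show "finite I" by (simp add: I_def)
    show "v q d \<in> carrier R" if "q \<in> I" for q d
      using that f t s by (auto simp: v_def I_def mem_upD)
    show "\<exists>d<K. v q d \<noteq> \<zero>" if q: "q \<in> I" for q
    proof (cases "q = (0, n)")
      case True
      have "\<exists>d. t \<otimes> f d \<noteq> \<zero>" using tf_nonzero[of \<one>] t f by (auto simp: mem_upD)
      then obtain d where d: "t \<otimes> f d \<noteq> \<zero>" by blast
      then have "d < K" using N[of d] t by (cases "N < d") (auto simp: K_def)
      then show ?thesis using d True by (auto simp: v_def)
    next
      case False
      then show ?thesis
        using q deg s_nonzero by (auto simp: I_def v_def intro!: exI[of _ "fst q"])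
    qed
    fix r assume r: "r \<in> I \<rightarrow> carrier R" and sum: "\<And>d. d < K \<Longrightarrow> (\<Oplus>q\<in>I. r q \<otimes> v q d) = \<zero>"
    define c where "c q = r q \<otimes> s (fst q) (snd q)" for q
    have c: "c (j, l) \<in> carrier R" if "j < K" "l < n" for j l
      using r s that by (auto simp: c_def I_def)
    define b where "b = r (0, n) \<otimes> t"
    have b: "b \<in> carrier R" using r t by (auto simp: b_def I_def)
    define G where "G l = truncated K (\<lambda>j. c (j, l))" for l
    have G: "G l \<in> up R" if "l < n" for l using c that by (auto simp: G_def truncated_closed)
    define L where "L = (\<Oplus>\<^bsub>S\<^esub>l\<in>{..<n}. mlt (G l) (const (w l)))"
    have L: "L \<in> up R"
      using S.finsum_closed[of "\<lambda>l. mlt (G l) (const (w l))" "{..<n}"] G by (auto simp: L_def)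
    \<comment> \<open>Given below \<open>K\<close>, the relation holds in all degrees, because no
      term reaches degree \<open>K\<close>; so it is an identity in \<open>S\<close>.\<close>
    have Ld: "L d \<oplus> b \<otimes> f d = \<zero>" for d
    proof (cases "d < K")
      case True
      have "(\<Oplus>q\<in>I. r q \<otimes> v q d) =
          r (0, n) \<otimes> v (0, n) d \<oplus> (\<Oplus>q\<in>{..<K} \<times> {..<n}. r q \<otimes> v q d)"
        unfolding I_def using r f t s
        by (intro finsum_insert) (auto simp: v_def I_def mem_upD Pi_def)
      also have "(\<Oplus>q\<in>{..<K} \<times> {..<n}. r q \<otimes> v q d) =
          (\<Oplus>q\<in>{..<K} \<times> {..<n}. c q \<otimes> (xop ^^ fst q) (const (w (snd q))) d)"
        using r s by (intro finsum_cong') (auto simp: v_def c_def I_def m_assoc Pi_def)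
      also have "\<dots> = L d"
        unfolding L_def G_def using c by (intro finsum_truncated_mult[symmetric]) auto
      also have "r (0, n) \<otimes> v (0, n) d = b \<otimes> f d"
        using r t f by (simp add: v_def b_def I_def m_assoc mem_upD)
      finally show ?thesis
        using sum[OF True] b f L by (simp add: a_comm mem_upD)
    next
      case False
      have "L d = (\<Oplus>q\<in>{..<K} \<times> {..<n}. c q \<otimes> (xop ^^ fst q) (const (w (snd q))) d)"
        unfolding L_def G_def using c by (intro finsum_truncated_mult) auto
      also have "\<dots> = \<zero>"
        using False c by (intro add.finprod_one_eqI) (auto simp: deg')
      finally show ?thesis using False N[of d] b by (simp add: K_def)
    qed
    define U where "U = const u"
    have U: "U \<in> carrier S" "U = const (w 0)" using n w0 wc[of 0] by (auto simp: U_def)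
    have WU: "const (w l) \<otimes>\<^bsub>S\<^esub> U = \<zero>\<^bsub>S\<^esub>" if "0 < l" "l < n" for l
      using tri[of 0 l] that n by (simp add: U(2) const_mult_const const_eq_zero)
    have total: "L \<oplus>\<^bsub>S\<^esub> const b \<otimes>\<^bsub>S\<^esub> f = \<zero>\<^bsub>S\<^esub>" using Ld b f by (simp add: const_mult)
    have LU: "L \<otimes>\<^bsub>S\<^esub> U = G 0 \<otimes>\<^bsub>S\<^esub> U \<otimes>\<^bsub>S\<^esub> U"
    proof -
      have "L \<otimes>\<^bsub>S\<^esub> U = (\<Oplus>\<^bsub>S\<^esub>l\<in>{..<n}. G l \<otimes>\<^bsub>S\<^esub> const (w l) \<otimes>\<^bsub>S\<^esub> U)"
        unfolding L_def using U G by (simp only: ore_simps(2)[symmetric], intro S.finsum_ldistr) auto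
      also have "\<dots> = G 0 \<otimes>\<^bsub>S\<^esub> const (w 0) \<otimes>\<^bsub>S\<^esub> U"
      proof (rule S.finsum_eq_single)
        show "G l \<otimes>\<^bsub>S\<^esub> const (w l) \<otimes>\<^bsub>S\<^esub> U = \<zero>\<^bsub>S\<^esub>" if "l \<in> {..<n}" "l \<noteq> 0" for l
        proof -
          have "G l \<otimes>\<^bsub>S\<^esub> const (w l) \<otimes>\<^bsub>S\<^esub> U = G l \<otimes>\<^bsub>S\<^esub> (const (w l) \<otimes>\<^bsub>S\<^esub> U)"
            using that G U(1) by (intro S.m_assoc) auto
          then show ?thesis using WU that G S.r_null[of "G l"] by simp
        qed
        show "G 0 \<otimes>\<^bsub>S\<^esub> const (w 0) \<otimes>\<^bsub>S\<^esub> U \<in> carrier S" using n G U by auto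
      qed (use n in auto)
      finally show ?thesis by (simp only: U(2))
    qed
    have cancel: "G l = (\<lambda>n. \<zero>)"
      if l: "l < n" and 0: "G l \<otimes>\<^bsub>S\<^esub> const (w l) \<otimes>\<^bsub>S\<^esub> const (w l) \<otimes>\<^bsub>S\<^esub> const (w l) = \<zero>\<^bsub>S\<^esub>" for l
    proof (rule mult_eq_zero_cancel[where g = "const (w l \<otimes> w l \<otimes> w l)" and e = 0])
      show "mlt (G l) (const (w l \<otimes> w l \<otimes> w l)) = (\<lambda>n. \<zero>)"
        using 0 l G by (simp add: mult_assoc const_mult_const m_assoc)
      show "G l j = \<zero>" if "G l j \<otimes> (\<sigma> ^^ j) (const (w l \<otimes> w l \<otimes> w l) 0) = \<zero>" for j
        using that s(3)[OF l, of "r (j, l)" j] r l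
        by (auto simp: const_at_0 G_def truncated_def c_def y_def I_def split: if_splits)
    qed (use l G in \<open>auto simp: const_pos\<close>)
    have fUU: "f \<otimes>\<^bsub>S\<^esub> U \<otimes>\<^bsub>S\<^esub> U = \<zero>\<^bsub>S\<^esub>" using fuu by (simp add: U_def)
    have bc: "const b \<in> carrier S" and fc: "f \<in> carrier S" and Lc: "L \<in> carrier S"
      and G0: "G 0 \<in> carrier S" using b f L G n by auto
    have "(L \<oplus>\<^bsub>S\<^esub> const b \<otimes>\<^bsub>S\<^esub> f) \<otimes>\<^bsub>S\<^esub> U = \<zero>\<^bsub>S\<^esub>" using total U(1) by (simp only: S.l_null)
    then have eqU: "G 0 \<otimes>\<^bsub>S\<^esub> U \<otimes>\<^bsub>S\<^esub> U \<oplus>\<^bsub>S\<^esub> const b \<otimes>\<^bsub>S\<^esub> (f \<otimes>\<^bsub>S\<^esub> U) = \<zero>\<^bsub>S\<^esub>"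
      using Lc bc fc U(1) LU by (simp only: S.l_distr S.m_assoc S.m_closed)
    then have "(G 0 \<otimes>\<^bsub>S\<^esub> U \<otimes>\<^bsub>S\<^esub> U \<oplus>\<^bsub>S\<^esub> const b \<otimes>\<^bsub>S\<^esub> (f \<otimes>\<^bsub>S\<^esub> U)) \<otimes>\<^bsub>S\<^esub> U = \<zero>\<^bsub>S\<^esub>"
      using U(1) by (simp only: S.l_null)
    then have "G 0 \<otimes>\<^bsub>S\<^esub> U \<otimes>\<^bsub>S\<^esub> U \<otimes>\<^bsub>S\<^esub> U \<oplus>\<^bsub>S\<^esub> const b \<otimes>\<^bsub>S\<^esub> (f \<otimes>\<^bsub>S\<^esub> U \<otimes>\<^bsub>S\<^esub> U) = \<zero>\<^bsub>S\<^esub>"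
      using G0 bc fc U(1) by (simp only: S.l_distr S.m_assoc S.m_closed)
    then have "G 0 \<otimes>\<^bsub>S\<^esub> U \<otimes>\<^bsub>S\<^esub> U \<otimes>\<^bsub>S\<^esub> U = \<zero>\<^bsub>S\<^esub>"
      using fUU G0 U(1) bc by (simp only: S.r_null S.r_zero S.m_closed)
    then have G00: "G 0 = \<zero>\<^bsub>S\<^esub>" using cancel[OF n] by (simp add: U(2))
    \<comment> \<open>The relation is now taken after a single multiplication by \<open>u\<close>,
      since a second one would annihilate the term containing \<open>b\<close>.\<close>
    then have "const b \<otimes>\<^bsub>S\<^esub> (f \<otimes>\<^bsub>S\<^esub> U) = \<zero>\<^bsub>S\<^esub>"
      using eqU U(1) bc fc by (simp only: S.l_null S.l_zero S.m_closed)
    then have "b \<otimes> mlt f (const u) m = \<zero>"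
      using b fu by (simp add: const_mult U_def fun_eq_iff)
    then have b0: "b = \<zero>" using t(3) r by (auto simp: b_def I_def)
    have L0: "L = \<zero>\<^bsub>S\<^esub>" using Ld b0 f L by (auto simp: fun_eq_iff mem_upD)
    \<comment> \<open>The remaining relation is triangular in the \<open>w l\<close>; the
      cancellation it demands holds for these \<open>G l\<close> by the choice of
      \<open>s\<close>.\<close>
    have GW: "G l \<otimes>\<^bsub>S\<^esub> const (w l) = \<zero>\<^bsub>S\<^esub>" if l: "l < n" for l
    proof (rule S.triangular_sum_zero[where n = n and w = "\<lambda>l. const (w l)" and f = G])
      show "const (w j) \<otimes>\<^bsub>S\<^esub> const (w i) = \<zero>\<^bsub>S\<^esub>" if "j < n" "i < j" for i j
        using tri that by (simp add: const_mult_const const_eq_zero)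
      show "G i \<otimes>\<^bsub>S\<^esub> const (w i) = \<zero>\<^bsub>S\<^esub>"
        if i: "i < n" and 0: "G i \<otimes>\<^bsub>S\<^esub> const (w i) \<otimes>\<^bsub>S\<^esub> const (w i) = \<zero>\<^bsub>S\<^esub>" for i
      proof -
        have "G i \<otimes>\<^bsub>S\<^esub> const (w i) \<otimes>\<^bsub>S\<^esub> const (w i) \<otimes>\<^bsub>S\<^esub> const (w i) = \<zero>\<^bsub>S\<^esub>"
          unfolding 0 using i by (intro S.l_null) auto
        then have "G i = \<zero>\<^bsub>S\<^esub>" using cancel[OF i] by simp
        then show ?thesis using S.l_null[of "const (w i)"] i by simp
      qed
      show "(\<Oplus>\<^bsub>S\<^esub>i\<in>{..<n}. G i \<otimes>\<^bsub>S\<^esub> const (w i)) = \<zero>\<^bsub>S\<^esub>" using L0 by (simp add: L_def)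
    qed (use G l in auto)
    have Gz: "G l = (\<lambda>n. \<zero>)" if l: "l < n" for l
    proof (rule cancel[OF l])
      show "G l \<otimes>\<^bsub>S\<^esub> const (w l) \<otimes>\<^bsub>S\<^esub> const (w l) \<otimes>\<^bsub>S\<^esub> const (w l) = \<zero>\<^bsub>S\<^esub>"
        using GW[OF l] by (simp add: mult_zero_left)
    qed
    have cz: "c (j, l) = \<zero>" if "j < K" "l < n" for j l
      using fun_cong[OF Gz[OF that(2)], of j] that by (simp add: G_def truncated_def)
    show "\<forall>q\<in>I. \<forall>d<K. r q \<otimes> v q d = \<zero>"
    proof (intro ballI allI impI)
      fix q d assume q: "q \<in> I"
      show "r q \<otimes> v q d = \<zero>"
      proof (cases "q = (0, n)")
        case True
        have "r (0, n) \<otimes> (t \<otimes> f d) = b \<otimes> f d"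
          using r t f by (simp add: b_def I_def m_assoc mem_upD)
        then show ?thesis using True b0 f by (simp add: v_def mem_upD)
      next
        case False
        then obtain j l where jl: "q = (j, l)" "j < K" "l < n" using q by (auto simp: I_def)
        have "r q \<otimes> (s j l \<otimes> (xop ^^ j) (const (w l)) d) = c (j, l) \<otimes> (xop ^^ j) (const (w l)) d"
          using jl r s q by (simp add: c_def m_assoc Pi_def)
        then show ?thesis using False jl cz by (simp add: v_def)
      qed
    qed
  qed
  then show False by (simp add: I_def)
qed

section \<open>The uniform dimension of the Ore extension\<close>

lemma udim_ore_ge:
  assumes cs: "complete_system R n u" shows "enat n \<le> udim S"
proof -
  have good: "good_element R (u l)" if "l < n" for l
    using cs that by (auto simp: complete_system_def good_system_def)
  note u [simp] = good_element_nonzero(1,2)[OF good]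
  have "independent_elements S n (\<lambda>l. const (u l))"
  proof (rule S.triangular_independent)
    show "const (u j) \<otimes>\<^bsub>S\<^esub> const (u i) = \<zero>\<^bsub>S\<^esub>" if "j < n" "i < j" for i j
      using cs that by (simp add: const_mult_const const_eq_zero complete_system_def good_system_def)
  qed (use good_element_cancel_ore[OF good] in \<open>auto simp: const_eq_zero\<close>)
  then show ?thesis by (rule S.udim_ge)
qed

text \<open>If \<open>p > n\<close> elements of \<open>S\<close> with degree less than \<open>D\<close> were independent, then their multiples
  by \<open>x\<^sup>j\<close> with \<open>j < K\<close> would, up to
  left multiples, give \<open>K p\<close> independent vectors of length \<open>K + D\<close>, which exceeds
  \<open>(K + D) n\<close> for large \<open>K\<close>.\<close>

lemma ore_independent_le:
  assumes cs: "complete_system R n u" and ind: "independent_elements S p g"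
  shows "p \<le> n"
proof (rule ccontr)
  assume "\<not> p \<le> n"
  then have pn: "Suc n \<le> p" by simp
  have g: "g i \<in> up R" "g i \<noteq> (\<lambda>n. \<zero>)" if "i < p" for i
    using ind that by (auto simp: independent_elements_def)
  have "\<exists>e. g i e \<noteq> \<zero> \<and> (\<forall>m>e. g i m = \<zero>)" if i: "i < p" for i
  proof -
    obtain k where k: "g i k \<noteq> \<zero>" using g(2)[OF i] by auto
    obtain N where N: "\<And>m. N < m \<Longrightarrow> g i m = \<zero>" using up_common_bound[OF g(1)[OF i] g(1)[OF i]] by metis
    then have bd: "m \<le> N" if "g i m \<noteq> \<zero>" for m using that by (meson not_le)
    show ?thesis
      using GreatestI_nat[of "\<lambda>m. g i m \<noteq> \<zero>" k N] k bd Greatest_le_nat[of "\<lambda>m. g i m \<noteq> \<zero>" _ N]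
      by (intro exI[of _ "GREATEST m. g i m \<noteq> \<zero>"]) (auto simp: not_le[symmetric])
  qed
  then obtain e where e: "\<And>i. i < p \<Longrightarrow> g i (e i) \<noteq> \<zero>" "\<And>i m. i < p \<Longrightarrow> e i < m \<Longrightarrow> g i m = \<zero>"
    by metis
  define D where "D = Suc (\<Sum>i<p. e i)"
  have eD: "e i < D" if "i < p" for i
    unfolding D_def using that by (intro le_imp_less_Suc member_le_sum) auto
  \<comment> \<open>\<open>K * Suc n \<le> (K + D) * n\<close> amounts to
    \<open>K \<le> D * n\<close>, so this is the least contradictory \<open>K\<close>.\<close>
  define K where "K = Suc (D * n)"
  define y where "y j i = (\<sigma> ^^ j) (g i (e i))" for j i
  have y: "y j i \<in> carrier R" "y j i \<noteq> \<zero>" if "i < p" for j i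
    unfolding y_def using that g e sgpow_nonzero by (auto simp: mem_upD)
  obtain h where h: "\<And>y. y \<in> carrier R \<Longrightarrow> y \<noteq> \<zero> \<Longrightarrow> h y \<in> carrier R"
      "\<And>y. y \<in> carrier R \<Longrightarrow> y \<noteq> \<zero> \<Longrightarrow> h y \<noteq> \<zero>"
      "\<And>y r. y \<in> carrier R \<Longrightarrow> y \<noteq> \<zero> \<Longrightarrow> r \<in> carrier R \<Longrightarrow> r \<otimes> h y \<otimes> y = \<zero> \<Longrightarrow> r \<otimes> h y = \<zero>"
    using annihilator_complements by blast
  define s where "s j i = h (y j i)" for j i
  have s: "\<And>j i. i < p \<Longrightarrow> s j i \<in> carrier R" "\<And>j i. i < p \<Longrightarrow> s j i \<noteq> \<zero>"
    "\<And>j i r. i < p \<Longrightarrow> r \<in> carrier R \<Longrightarrow> r \<otimes> s j i \<otimes> y j i = \<zero> \<Longrightarrow> r \<otimes> s j i = \<zero>"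
    unfolding s_def by (intro h y; assumption)+
  define v where "v q d = s (fst q) (snd q) \<otimes> (xop ^^ fst q) (g (snd q)) d" for q d
  define I where "I = {..<K} \<times> {..<p}"
  have deg: "(xop ^^ j) (g i) (j + e i) = y j i" "j + e i < d \<Longrightarrow> (xop ^^ j) (g i) d = \<zero>"
    if "i < p" for j i d
    using Xpow_degree[of "g i" "e i" j] g e that by (auto simp: y_def)
  have "card I \<le> (K + D) * n"
  proof (rule complete_system_bound[OF cs])
    show "finite I" by (simp add: I_def)
    show "v q d \<in> carrier R" if "q \<in> I" for q d
      using that g s by (auto simp: v_def I_def)
    show "\<exists>d<K + D. v q d \<noteq> \<zero>" if q: "q \<in> I" for q
    proof -
      obtain j i where ji: "q = (j, i)" "j < K" "i < p" using q by (auto simp: I_def)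
      have "s j i \<otimes> y j i \<noteq> \<zero>" using s(3)[OF ji(3), of \<one> j] s(1,2)[OF ji(3)] by auto
      then show ?thesis
        using ji deg eD[of i] by (intro exI[of _ "j + e i"]) (auto simp: v_def)
    qed
    fix r assume r: "r \<in> I \<rightarrow> carrier R" and sum: "\<And>d. d < K + D \<Longrightarrow> (\<Oplus>q\<in>I. r q \<otimes> v q d) = \<zero>"
    define c where "c q = r q \<otimes> s (fst q) (snd q)" for q
    have c: "c (j, i) \<in> carrier R" if "j < K" "i < p" for j i
      using r s that by (auto simp: c_def I_def)
    define G where "G i = truncated K (\<lambda>j. c (j, i))" for i
    have G: "G i \<in> up R" if "i < p" for i using c that by (auto simp: G_def truncated_closed)
    \<comment> \<open>Coefficients from \<open>K + D\<close> on vanish by degree, so the relation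
      between vectors is one in \<open>S\<close>.\<close>
    have "(\<Oplus>\<^bsub>S\<^esub>i\<in>{..<p}. mlt (G i) (g i)) d = \<zero>" for d
    proof -
      have "(\<Oplus>\<^bsub>S\<^esub>i\<in>{..<p}. mlt (G i) (g i)) d =
          (\<Oplus>q\<in>{..<K} \<times> {..<p}. c q \<otimes> (xop ^^ fst q) (g (snd q)) d)"
        unfolding G_def using c g by (intro finsum_truncated_mult) auto
      also have "\<dots> = \<zero>"
      proof (cases "d < K + D")
        case True
        have "(\<Oplus>q\<in>I. c q \<otimes> (xop ^^ fst q) (g (snd q)) d) = (\<Oplus>q\<in>I. r q \<otimes> v q d)"
          using r s g by (intro finsum_cong') (auto simp: v_def c_def I_def m_assoc Pi_def)
        then show ?thesis using sum[OF True] by (simp add: I_def)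
      next
        case False
        show ?thesis
        proof (intro add.finprod_one_eqI)
          fix q assume q: "q \<in> {..<K} \<times> {..<p}"
          then have "(xop ^^ fst q) (g (snd q)) d = \<zero>"
            using False eD[of "snd q"] by (intro deg(2)) auto
          then show "c q \<otimes> (xop ^^ fst q) (g (snd q)) d = \<zero>" using q c by auto
        qed
      qed
      finally show ?thesis .
    qed
    then have "(\<Oplus>\<^bsub>S\<^esub>i\<in>{..<p}. G i \<otimes>\<^bsub>S\<^esub> g i) = \<zero>\<^bsub>S\<^esub>" by (simp add: fun_eq_iff)
    then have "\<forall>i<p. G i \<otimes>\<^bsub>S\<^esub> g i = \<zero>\<^bsub>S\<^esub>"
      using ind[unfolded independent_elements_def, THEN conjunct2, rule_format, of G] G by simp
    then have Gg: "mlt (G i) (g i) = (\<lambda>n. \<zero>)" if "i < p" for i using that by simp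
    \<comment> \<open>Independence in \<open>S\<close> yields only \<open>G i g i = 0\<close>. Since
      coefficient \<open>j\<close> of \<open>G i\<close> is a left multiple of \<open>s j i\<close>,
      comparing leading terms then forces \<open>G i = 0\<close>.\<close>
    have reg: "G i j = \<zero>" if "i < p" "G i j \<otimes> (\<sigma> ^^ j) (g i (e i)) = \<zero>" for i j
      using that s(3)[OF that(1), of "r (j, i)" j] r
      by (auto simp: G_def truncated_def c_def y_def I_def split: if_splits)
    have Gz: "G i = (\<lambda>n. \<zero>)" if "i < p" for i
      using mult_eq_zero_cancel[OF G[OF that] g(1)[OF that] e(2)[OF that] reg[OF that] Gg[OF that]] .
    show "\<forall>q\<in>I. \<forall>d<K + D. r q \<otimes> v q d = \<zero>"
    proof (intro ballI allI impI)
      fix q d assume q: "q \<in> I"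
      then obtain j i where ji: "q = (j, i)" "j < K" "i < p" by (auto simp: I_def)
      then have "c (j, i) = \<zero>"
        using fun_cong[OF Gz[of i], of j] by (simp add: G_def truncated_def)
      moreover have "r q \<otimes> (s j i \<otimes> (xop ^^ j) (g i) d) = c (j, i) \<otimes> (xop ^^ j) (g i) d"
        using ji r s g q by (simp add: c_def m_assoc Pi_def)
      ultimately show "r q \<otimes> v q d = \<zero>" using ji g by (simp add: v_def)
    qed
  qed
  then have "K * p \<le> (K + D) * n" by (simp add: I_def card_cartesian_product)
  moreover have "K * Suc n \<le> K * p" using pn by (rule mult_le_mono2)
  ultimately have "K * Suc n \<le> (K + D) * n" by linarith
  then show False by (simp add: K_def algebra_simps)
qed

lemma udim_ore: "udim S = udim R"
proof -
  have "good_system R 0 (\<lambda>_. \<zero>)" by (simp add: good_system_def)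
  then obtain n u where cs: "complete_system R n u" using complete_system_extends by blast
  have "udim S = enat n"
    using S.udim_le[of n] ore_independent_le[OF cs] udim_ore_ge[OF cs] by (intro antisym) auto
  then show ?thesis using udim_complete_system[OF cs] by simp
qed

end

section \<open>The uniform dimension of the Jordan extension\<close>

context semiprime_left_goldie
begin

text \<open>This is the cancellation in \<open>R[x; \<sigma>]\<close> with the trivial \<open>\<sigma>\<close>-derivation, applied to \<open>r x\<^sup>N\<close>.\<close>

lemma good_element_cancel_endo:
  assumes \<sigma>: "\<sigma> \<in> ring_hom R R" "inj_on \<sigma> (carrier R)" and u: "good_element R u"
    and r: "r \<in> carrier R" and 0: "r \<otimes> (\<sigma> ^^ N) u \<otimes> (\<sigma> ^^ N) u = \<zero>"
  shows "r \<otimes> (\<sigma> ^^ N) u = \<zero>"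
proof -
  define \<zeta> :: "'a \<Rightarrow> 'a" where "\<zeta> = (\<lambda>_. \<zero>)"
  interpret goldie_ore_data R \<sigma> \<zeta>
    using \<sigma> ring_axioms semiprime_left_goldie_axioms
    by (intro goldie_ore_data.intro ore_data.intro ore_data_axioms.intro
        goldie_ore_data_axioms.intro)
       (simp_all add: sigma_derivation_def ring_hom_closed[of \<sigma> R R] \<zeta>_def)
  have uc [simp]: "u \<in> carrier R" by (rule good_element_nonzero(1)[OF u])
  define mon where "mon a = (\<lambda>n. if n = N then a else \<zero>)" for a
  have mon_closed: "mon a \<in> up R" if "a \<in> carrier R" for a
  proof
    show "\<exists>n. bound \<zero> n (mon a)" by (intro exI[of _ N] bound.intro) (simp add: mon_def)
  qed (use that in \<open>simp add: mon_def\<close>)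
  \<comment> \<open>With zero derivation \<open>x^i u\<close> is the monomial with coefficient
    \<open>(\<sigma> ^^ i) u\<close>, so \<open>u\<close> acts on a monomial of degree
    \<open>N\<close> through \<open>(\<sigma> ^^ N) u\<close>.\<close>
  have pow: "(xop ^^ i) (const u) = (\<lambda>n. if n = i then (\<sigma> ^^ i) u else \<zero>)" for i
  proof (induction i)
    case (Suc i)
    have "(xop ^^ Suc i) (const u) = xop (\<lambda>n. if n = i then (\<sigma> ^^ i) u else \<zero>)"
      using Suc by simp
    also have "\<dots> = (\<lambda>n. if n = Suc i then (\<sigma> ^^ Suc i) u else \<zero>)"
    proof
      show "xop (\<lambda>n. if n = i then (\<sigma> ^^ i) u else \<zero>) n =
          (if n = Suc i then (\<sigma> ^^ Suc i) u else \<zero>)" for n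
        by (cases n) (auto simp: ore_x_def \<zeta>_def)
    qed
    finally show ?case .
  qed (simp add: const_def fun_eq_iff)
  have mult: "mlt (mon a) (const u) = mon (a \<otimes> (\<sigma> ^^ N) u)" if a: "a \<in> carrier R" for a
  proof
    fix n
    have "mlt (mon a) (const u) n = (\<Oplus>i\<in>{..N}. mon a i \<otimes> (xop ^^ i) (const u) n)"
      using a by (intro mult_eq mon_closed const_closed) (auto simp: mon_def)
    also have "\<dots> = mon a N \<otimes> (xop ^^ N) (const u) n"
      using a by (intro finsum_eq_single) (auto simp: mon_def)
    finally show "mlt (mon a) (const u) n = mon (a \<otimes> (\<sigma> ^^ N) u) n"
      using a by (simp add: mon_def pow)
  qed
  have "mlt (mlt (mon r) (const u)) (const u) = (\<lambda>n. \<zero>)"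
    using r 0 by (simp add: mult) (simp add: mon_def)
  from good_element_cancel_ore[OF u mon_closed[OF r] this]
  have "mon (r \<otimes> (\<sigma> ^^ N) u) N = \<zero>" using r by (simp add: mult)
  then show ?thesis by (simp add: mon_def)
qed

text \<open>Relations in \<open>A\<close> are tested after a power of the automorphism \<tau> has
  moved them into \<open>R\<close>. That power depends on the coefficient and changes
  \<open>u l\<close> into \<open>(\<sigma> ^^ N) (u l)\<close>, which is why cancellation is needed
  for every \<open>N\<close>.\<close>

lemma udim_jordan_extension:
  assumes \<sigma>: "\<sigma> \<in> ring_hom R R" "inj_on \<sigma> (carrier R)" and "jordan_extension R \<sigma> A \<iota>"
  shows "udim A = udim R"
proof -
  obtain \<tau> where A: "ring A" and \<iota>: "\<iota> \<in> ring_hom R A" "inj_on \<iota> (carrier R)"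
    and \<tau>: "\<tau> \<in> ring_iso A A" "\<And>r. r \<in> carrier R \<Longrightarrow> \<tau> (\<iota> r) = \<iota> (\<sigma> r)"
    and union: "carrier A = (\<Union>i. {a \<in> carrier A. (\<tau> ^^ i) a \<in> \<iota> ` carrier R})"
    using assms(3) by (auto simp: jordan_extension_def)
  interpret A: ring A by (rule A)
  interpret \<iota>: ring_hom_ring R A \<iota>
    by (rule ring_hom_ringI2[OF ring_axioms A \<iota>(1)])
  have \<iota>0: "r = \<zero>" if "r \<in> carrier R" "\<iota> r = \<zero>\<^bsub>A\<^esub>" for r
    using that inj_onD[OF \<iota>(2), of r \<zero>] by simp
  have iso: "\<tau> ^^ i \<in> ring_iso A A" for i
  proof (induction i)
    case (Suc i)
    then show ?case using ring_iso_set_trans[OF Suc \<tau>(1)] by (simp add: comp_def)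
  qed (simp add: id_def[symmetric] ring_iso_set_refl)
  have \<tau>hom: "ring_hom_ring A A (\<tau> ^^ i)" for i
    using iso by (intro ring_hom_ringI2 A) (auto simp: ring_iso_def)
  have \<tau>bij: "bij_betw (\<tau> ^^ i) (carrier A) (carrier A)" for i
    using iso by (auto simp: ring_iso_def)
  have \<tau>0: "a = \<zero>\<^bsub>A\<^esub>" if "a \<in> carrier A" "(\<tau> ^^ i) a = \<zero>\<^bsub>A\<^esub>" for a i
  proof -
    interpret t: ring_hom_ring A A "\<tau> ^^ i" by (rule \<tau>hom)
    show ?thesis
      using that inj_onD[OF bij_betw_imp_inj_on[OF \<tau>bij], of i a "\<zero>\<^bsub>A\<^esub>"] by simp
  qed
  have \<sigma>pow: "(\<sigma> ^^ i) r \<in> carrier R" "(\<tau> ^^ i) (\<iota> r) = \<iota> ((\<sigma> ^^ i) r)"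
    if "r \<in> carrier R" for r i
  proof -
    show *: "(\<sigma> ^^ i) r \<in> carrier R" for i
      using that ring_hom_closed[OF \<sigma>(1)] by (induction i) auto
    show "(\<tau> ^^ i) (\<iota> r) = \<iota> ((\<sigma> ^^ i) r)" using * by (induction i) (auto simp: \<tau>(2))
  qed
  \<comment> \<open>An element that has entered the image of \<open>R\<close> stays there, as \<tau>
    acts on it by \<sigma>; hence finitely many elements share a level.\<close>
  have "\<exists>i. \<forall>j\<ge>i. (\<tau> ^^ j) a \<in> \<iota> ` carrier R" if a: "a \<in> carrier A" for a
  proof -
    obtain i r where i: "(\<tau> ^^ i) a = \<iota> r" "r \<in> carrier R"
      using subsetD[OF equalityD1[OF union] a] by blast
    have "(\<tau> ^^ j) a \<in> \<iota> ` carrier R" if "i \<le> j" for j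
    proof -
      have "(\<tau> ^^ j) a = (\<tau> ^^ (j - i)) ((\<tau> ^^ i) a)"
        using that by (simp add: funpow_add[symmetric, THEN fun_cong, unfolded comp_apply])
      also have "\<dots> = \<iota> ((\<sigma> ^^ (j - i)) r)" using \<sigma>pow(2) i by simp
      finally show ?thesis using \<sigma>pow(1)[OF i(2)] by blast
    qed
    then show ?thesis by blast
  qed
  then obtain lvl where lvl: "(\<tau> ^^ j) a \<in> \<iota> ` carrier R" if "a \<in> carrier A" "lvl a \<le> j" for a j
    by metis
  have "good_system R 0 (\<lambda>_. \<zero>)" by (simp add: good_system_def)
  then obtain n u where cs: "complete_system R n u" using complete_system_extends by blast
  have good: "good_element R (u l)" if "l < n" for l
    using cs that by (auto simp: complete_system_def good_system_def)
  note u [simp] = good_element_nonzero(1,2)[OF good]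
  have "independent_elements A n (\<lambda>l. \<iota> (u l))"
  proof (rule A.triangular_independent)
    show "\<iota> (u l) \<noteq> \<zero>\<^bsub>A\<^esub>" if "l < n" for l using \<iota>0 that u by blast
    show "\<iota> (u j) \<otimes>\<^bsub>A\<^esub> \<iota> (u i) = \<zero>\<^bsub>A\<^esub>" if "j < n" "i < j" for i j
      using cs that \<iota>.hom_mult[of "u j" "u i"] by (simp add: complete_system_def good_system_def)
    show "a \<otimes>\<^bsub>A\<^esub> \<iota> (u l) = \<zero>\<^bsub>A\<^esub>"
      if l: "l < n" and a: "a \<in> carrier A" and 0: "a \<otimes>\<^bsub>A\<^esub> \<iota> (u l) \<otimes>\<^bsub>A\<^esub> \<iota> (u l) = \<zero>\<^bsub>A\<^esub>" for l a
    proof -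
      define N where "N = lvl a"
      interpret t: ring_hom_ring A A "\<tau> ^^ N" by (rule \<tau>hom)
      obtain r where r: "r \<in> carrier R" "(\<tau> ^^ N) a = \<iota> r" using lvl[OF a] by (auto simp: N_def)
      let ?w = "(\<sigma> ^^ N) (u l)"
      have w: "?w \<in> carrier R" "(\<tau> ^^ N) (\<iota> (u l)) = \<iota> ?w" using \<sigma>pow l by auto
      have "(\<tau> ^^ N) (a \<otimes>\<^bsub>A\<^esub> \<iota> (u l) \<otimes>\<^bsub>A\<^esub> \<iota> (u l)) = \<iota> (r \<otimes> ?w \<otimes> ?w)"
        using a r w l by simp
      then have "r \<otimes> ?w \<otimes> ?w = \<zero>" using 0 r w by (intro \<iota>0) auto
      then have "r \<otimes> ?w = \<zero>" by (rule good_element_cancel_endo[OF \<sigma> good[OF l] r(1)])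
      moreover have "(\<tau> ^^ N) (a \<otimes>\<^bsub>A\<^esub> \<iota> (u l)) = \<iota> (r \<otimes> ?w)"
        using a r w l by simp
      ultimately have "(\<tau> ^^ N) (a \<otimes>\<^bsub>A\<^esub> \<iota> (u l)) = \<zero>\<^bsub>A\<^esub>" by simp
      moreover have "a \<otimes>\<^bsub>A\<^esub> \<iota> (u l) \<in> carrier A" using a l by simp
      ultimately show ?thesis using \<tau>0 by blast
    qed
  qed simp
  then have ge: "enat n \<le> udim A" by (rule A.udim_ge)
  have "p \<le> n" if ind: "independent_elements A p v" for p v
  proof -
    have v: "v i \<in> carrier A" "v i \<noteq> \<zero>\<^bsub>A\<^esub>" if "i < p" for i
      using ind that by (auto simp: independent_elements_def)
    define N where "N = (\<Sum>i<p. lvl (v i))"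
    have "lvl (v i) \<le> N" if "i < p" for i
      unfolding N_def using that by (intro member_le_sum) auto
    then have "\<exists>x. x \<in> carrier R \<and> (\<tau> ^^ N) (v i) = \<iota> x" if "i < p" for i
      using lvl[OF v(1)] that by blast
    then obtain x where x: "\<And>i. i < p \<Longrightarrow> x i \<in> carrier R" "\<And>i. i < p \<Longrightarrow> (\<tau> ^^ N) (v i) = \<iota> (x i)"
      by metis
    interpret t: ring_hom_ring A A "\<tau> ^^ N" by (rule \<tau>hom)
    have "independent_elements R p x"
      unfolding independent_elements_def
    proof (intro conjI allI impI)
      show "x i \<in> carrier R" if "i < p" for i using x that by simp
      show "x i \<noteq> \<zero>" if "i < p" for i
      proof
        assume "x i = \<zero>"
        then have "(\<tau> ^^ N) (v i) = \<zero>\<^bsub>A\<^esub>" using x(2)[OF that] by simp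
        then show False using \<tau>0 v that by blast
      qed
      fix r i assume r: "(\<forall>i<p. r i \<in> carrier R) \<and> (\<Oplus>i\<in>{..<p}. r i \<otimes> x i) = \<zero>" and i: "i < p"
      \<comment> \<open>Coefficients from \<open>R\<close> are pulled back along the bijection
        \<open>\<tau> ^^ N\<close>, so that independence in \<open>A\<close> applies to
        them.\<close>
      have "\<exists>b. b \<in> carrier A \<and> (\<tau> ^^ N) b = \<iota> (r i)" if "i < p" for i
        using bij_betw_imp_surj_on[OF \<tau>bij[of N]] r that \<iota>.hom_closed by (metis imageE)
      then obtain b where b: "\<And>i. i < p \<Longrightarrow> b i \<in> carrier A" "\<And>i. i < p \<Longrightarrow> (\<tau> ^^ N) (b i) = \<iota> (r i)"
        by metis
      have bv: "(\<tau> ^^ N) (b i \<otimes>\<^bsub>A\<^esub> v i) = \<iota> (r i \<otimes> x i)" if "i < p" for i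
        using b v x r that by simp
      have "(\<tau> ^^ N) (\<Oplus>\<^bsub>A\<^esub>i\<in>{..<p}. b i \<otimes>\<^bsub>A\<^esub> v i) = (\<Oplus>\<^bsub>A\<^esub>i\<in>{..<p}. (\<tau> ^^ N) (b i \<otimes>\<^bsub>A\<^esub> v i))"
        using b v by (subst t.hom_finsum) (auto simp: comp_def)
      also have "\<dots> = (\<Oplus>\<^bsub>A\<^esub>i\<in>{..<p}. \<iota> (r i \<otimes> x i))"
        using bv r x by (intro A.finsum_cong') auto
      also have "\<dots> = \<iota> (\<Oplus>i\<in>{..<p}. r i \<otimes> x i)"
        using r x by (subst \<iota>.hom_finsum) (auto simp: comp_def)
      also have "\<dots> = \<zero>\<^bsub>A\<^esub>" using r by simp
      finally have "(\<tau> ^^ N) (\<Oplus>\<^bsub>A\<^esub>i\<in>{..<p}. b i \<otimes>\<^bsub>A\<^esub> v i) = \<zero>\<^bsub>A\<^esub>" .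
      moreover have "(\<Oplus>\<^bsub>A\<^esub>i\<in>{..<p}. b i \<otimes>\<^bsub>A\<^esub> v i) \<in> carrier A"
        using b(1) v(1) by (intro A.finsum_closed) auto
      ultimately have "(\<Oplus>\<^bsub>A\<^esub>i\<in>{..<p}. b i \<otimes>\<^bsub>A\<^esub> v i) = \<zero>\<^bsub>A\<^esub>" by (rule \<tau>0[rotated])
      then have "b i \<otimes>\<^bsub>A\<^esub> v i = \<zero>\<^bsub>A\<^esub>"
        using ind b(1) i unfolding independent_elements_def by blast
      then have "\<iota> (r i \<otimes> x i) = \<zero>\<^bsub>A\<^esub>" using bv[OF i] by simp
      then show "r i \<otimes> x i = \<zero>" using r x i by (intro \<iota>0) auto
    qed
    then show "p \<le> n" by (rule complete_system_independent_le[OF cs])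
  qed
  then have "udim A \<le> enat n" by (rule A.udim_le)
  then show ?thesis using ge udim_complete_system[OF cs] by simp
qed

end

theorem theorem3p4:
  fixes R :: "('a, 'm) ring_scheme" and A :: "('b, 'k) ring_scheme"
    and \<sigma> \<delta> :: "'a \<Rightarrow> 'a" and \<iota> :: "'a \<Rightarrow> 'b"
  assumes "ring R" and "semiprime_ring R" and "left_goldie R"
    and "\<sigma> \<in> ring_hom R R" and "inj_on \<sigma> (carrier R)"
    and "jordan_extension R \<sigma> A \<iota>"
    and "sigma_derivation R \<sigma> \<delta>"
  shows "udim (ore_extension R \<sigma> \<delta>) = udim R \<and> udim R = udim A"
proof -
  interpret goldie_ore_data R \<sigma> \<delta>
    using assms
    by (intro goldie_ore_data.intro ore_data.intro semiprime_left_goldie.intro ore_data_axioms.intro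
        semiprime_left_goldie_axioms.intro goldie_ore_data_axioms.intro)
  show ?thesis
    using udim_ore udim_jordan_extension[OF assms(4-6)] by simp
qed

end
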